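(* Let $A$, $B$, $O=B^*$, $T>0$ and the operators $W^T$, $W_\#^T$, $C^T$ be as in the context. Assume: (a) the spectrum of $A$ is simple, i.e. it consists of (infinitely many) eigenvalues with algebraic multiplicity one, denoted $\{\lambda_k\}_{k=1}^\infty$, and the adjoint operator $A^*$ has spectrum $\{\overline{\lambda_k}\}_{k=1}^\infty$; (b) the eigenfunctions $\{\varphi_k\}_{k=1}^\infty$ of $A$ form a Riesz basis in $H$, the basis of eigenfunctions of $A^*$ is denoted $\{\psi_k\}_{k=1}^\infty$, and $(\varphi_k,\psi_l)_H=\delta_{kl}$; (c) both control systems of the context are spectrally controllable, i.e. there exist controls $f_k,g_k\in H_0^1((0,T);Y)$ such that $W^Tf_k=\varphi_k$ and $W_\#^Tg_k=\psi_k$. Then the spectral data $\{\lambda_k,O\varphi_k,O\psi_k\}_{k=1}^\infty$ of $A$ are calculated by the following method. (1) Solve the generalized spectral problems $$C^T\dot f_k+i\lambda_kC^Tf_k=0,\qquad (C^T)^*\dot g_k-i\overline{\lambda_k}(C^T)^*g_k=0$$ to find the spectrum $\{\lambda_k\}_{k=1}^\infty$ and the controls $f_k,g_k$, $k=1,2,\ldots$ (the dot is $d/dt$). (2) Normalize the controls by $(C^Tf_k,g_k)_{\mathcal F^T}=1$. (3) Recover the traces of the eigenfunctions by $$-iO\varphi_k=e^{-i\lambda_k(t-T)}(C^Tf_k)(t)=(C^Tf_k)(T),$$ $$iO\psi_k=e^{i\overline{\lambda_k}(t-T)}\big((C^T)^*g_k\big)(t)=\big((C^T)^*g_k\big)(T),$$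 where $\varphi_k=W^Tf_k$ and $\psi_k=W_\#^Tg_k$.
   Context: $H$ and $Y$ are Hilbert spaces, $A$ is an operator in $H$, not necessarily self-adjoint, with adjoint $A^*$, $B:Y\to H$ is an input operator and $O=B^*:H\to Y$ is the observation operator. $T>0$ is fixed and $\mathcal F^T=L^2((0,T);Y)$. For $f\in\mathcal F^T$, $u^f$ denotes the solution of $iu_t-Au=Bf$, $t>0$, $u(0)=0$; for $g\in\mathcal F^T$, $v^g$ denotes the solution of $iv_t+A^*v=-Bg$, $t>0$, $v(0)=0$. These are the two control systems. The control operators $W^T,W_\#^T:\mathcal F^T\to H$ are $W^Tf=u^f(T)$ and $W_\#^Tg=v^g(T)$. The connecting operator $C^T:\mathcal F^T\to\mathcal F^T$ is defined by $(C^Tf,g)_{\mathcal F^T}=(u^f(T),v^g(T))_H=(W^Tf,W_\#^Tg)_H$. *)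

theory Defs
  imports "HOL-Analysis.Analysis"
begin

section \<open>Complex Hilbert spaces\<close>

text \<open>HOL-Analysis only has real inner product spaces.  A complex Hilbert space is a complete real
  inner product space with a complex scalar multiplication and a sesquilinear form, linear in the
  first argument, whose real part is the given real inner product; hence the norm is
  \<open>sqrt (Re (cinner x x))\<close>, and the library's topology, derivatives and integrals apply.\<close>

class chilbert_space = real_inner + complete_space +
  fixes scaleC :: "complex \<Rightarrow> 'a \<Rightarrow> 'a" (infixr "*\<^sub>C" 75)
    and cinner :: "'a \<Rightarrow> 'a \<Rightarrow> complex"
  assumes scaleC_add_right: "a *\<^sub>C (x + y) = a *\<^sub>C x + a *\<^sub>C y"
    and scaleC_add_left: "(a + b) *\<^sub>C x = a *\<^sub>C x + b *\<^sub>C x"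
    and scaleC_scaleC: "a *\<^sub>C b *\<^sub>C x = (a * b) *\<^sub>C x"
    and scaleC_of_real: "complex_of_real r *\<^sub>C x = r *\<^sub>R x"
    and cinner_add_left: "cinner (x + y) z = cinner x z + cinner y z"
    and cinner_scaleC_left: "cinner (a *\<^sub>C x) y = a * cinner x y"
    and cinner_commute: "cinner x y = cnj (cinner y x)"
    and Re_cinner: "Re (cinner x y) = inner x y"

definition bounded_clinear :: "('a::chilbert_space \<Rightarrow> 'b::chilbert_space) \<Rightarrow> bool" where
  "bounded_clinear V \<longleftrightarrow> bounded_linear V \<and> (\<forall>a x. V (a *\<^sub>C x) = a *\<^sub>C V x)"

definition is_adjoint :: "('a::chilbert_space \<Rightarrow> 'b::chilbert_space) \<Rightarrow> ('b \<Rightarrow> 'a) \<Rightarrow> bool" where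
  "is_adjoint V V' \<longleftrightarrow> (\<forall>x y. cinner (V x) y = cinner x (V' y))"

definition orthonormal_basis :: "(nat \<Rightarrow> 'a::chilbert_space) \<Rightarrow> bool" where
  "orthonormal_basis e \<longleftrightarrow>
     (\<forall>j k. cinner (e j) (e k) = (if j = k then 1 else 0)) \<and>
     closure {\<Sum>k<n. c k *\<^sub>C e k | (n::nat) c. True} = UNIV"

definition riesz_basis :: "(nat \<Rightarrow> 'a::chilbert_space) \<Rightarrow> bool" where
  "riesz_basis \<phi> \<longleftrightarrow>
     (\<exists>(e :: nat \<Rightarrow> 'a) V. orthonormal_basis e \<and> bounded_clinear V \<and> bij V \<and> (\<forall>k. \<phi> k = V (e k)))"

section \<open>Unbounded operators\<close>

text \<open>An operator is given by its domain \<open>D\<close> and a total function \<open>A\<close>, only used on \<open>D\<close>.\<close>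

definition densely_defined_operator ::
    "'a::chilbert_space set \<Rightarrow> ('a \<Rightarrow> 'a) \<Rightarrow> bool" where
  "densely_defined_operator D A \<longleftrightarrow>
     0 \<in> D \<and> closure D = UNIV \<and>
     (\<forall>x\<in>D. \<forall>y\<in>D. x + y \<in> D \<and> A (x + y) = A x + A y) \<and>
     (\<forall>a. \<forall>x\<in>D. a *\<^sub>C x \<in> D \<and> A (a *\<^sub>C x) = a *\<^sub>C A x)"

definition adj_dom :: "'a::chilbert_space set \<Rightarrow> ('a \<Rightarrow> 'a) \<Rightarrow> 'a set" where
  "adj_dom D A = {y. \<exists>z. \<forall>x\<in>D. cinner (A x) y = cinner x z}"

definition adj_op :: "'a::chilbert_space set \<Rightarrow> ('a \<Rightarrow> 'a) \<Rightarrow> 'a \<Rightarrow> 'a" where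
  "adj_op D A y = (THE z. \<forall>x\<in>D. cinner (A x) y = cinner x z)"

definition op_spectrum :: "'a::chilbert_space set \<Rightarrow> ('a \<Rightarrow> 'a) \<Rightarrow> complex set" where
  "op_spectrum D A =
     - {\<mu>. bij_betw (\<lambda>x. A x - \<mu> *\<^sub>C x) D UNIV \<and>
           (\<exists>K. \<forall>x\<in>D. norm x \<le> K * norm (A x - \<mu> *\<^sub>C x))}"

definition eigenvector ::
    "'a::chilbert_space set \<Rightarrow> ('a \<Rightarrow> 'a) \<Rightarrow> complex \<Rightarrow> 'a \<Rightarrow> bool" where
  "eigenvector D A \<mu> x \<longleftrightarrow> x \<in> D \<and> x \<noteq> 0 \<and> A x = \<mu> *\<^sub>C x"

definition root_space ::
    "'a::chilbert_space set \<Rightarrow> ('a \<Rightarrow> 'a) \<Rightarrow> complex \<Rightarrow> 'a set" where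
  "root_space D A \<mu> =
     {x. \<exists>n. (\<forall>j<n. ((\<lambda>z. A z - \<mu> *\<^sub>C z) ^^ j) x \<in> D) \<and> ((\<lambda>z. A z - \<mu> *\<^sub>C z) ^^ n) x = 0}"

definition alg_simple_eigenvalue ::
    "'a::chilbert_space set \<Rightarrow> ('a \<Rightarrow> 'a) \<Rightarrow> complex \<Rightarrow> bool" where
  "alg_simple_eigenvalue D A \<mu> \<longleftrightarrow> (\<exists>x. x \<noteq> 0 \<and> root_space D A \<mu> = {c *\<^sub>C x | c. True})"

section \<open>Vector-valued function spaces on an interval\<close>

text \<open>Elements of \<open>L\<^sup>2((0,T); Y)\<close> are represented by functions, equality being equality almost
  everywhere.  Measurability is strong measurability, so \<open>Y\<close> need not be separable; for the same
  reason \<open>Y\<close>-valued integrals below are taken with \<open>has_integral\<close>, which agrees with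
  the Bochner integral on Bochner integrable functions.\<close>

abbreviation interval_measure :: "real \<Rightarrow> real measure" where
  "interval_measure T \<equiv> lebesgue_on {0<..<T}"

definition strongly_measurable :: "'m measure \<Rightarrow> ('m \<Rightarrow> 'a::metric_space) \<Rightarrow> bool" where
  "strongly_measurable M f \<longleftrightarrow>
     (\<exists>s. (\<forall>n::nat. simple_function M (s n)) \<and> (AE t in M. (\<lambda>n. s n t) \<longlonglongrightarrow> f t))"

definition L2_space :: "real \<Rightarrow> (real \<Rightarrow> 'a::chilbert_space) set" where
  "L2_space T = {f. strongly_measurable (interval_measure T) f \<and>
                    integrable (interval_measure T) (\<lambda>t. (norm (f t))\<^sup>2)}"

definition L2_inner ::
    "real \<Rightarrow> (real \<Rightarrow> 'a::chilbert_space) \<Rightarrow> (real \<Rightarrow> 'a) \<Rightarrow> complex" where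
  "L2_inner T f g = (\<integral>t. cinner (f t) (g t) \<partial>interval_measure T)"

text \<open>\<open>f\<close> belongs to \<open>H\<^sub>0\<^sup>1((0,T); Y)\<close>, taken as its absolutely continuous representative
  on \<open>[0,T]\<close>, and its derivative is \<open>f'\<close>.\<close>

definition has_H10_deriv ::
    "real \<Rightarrow> (real \<Rightarrow> 'a::chilbert_space) \<Rightarrow> (real \<Rightarrow> 'a) \<Rightarrow> bool" where
  "has_H10_deriv T f f' \<longleftrightarrow>
     f' \<in> L2_space T \<and> (\<forall>t\<in>{0..T}. (f' has_integral f t) {0..t}) \<and> f T = 0"

definition H10_space :: "real \<Rightarrow> (real \<Rightarrow> 'a::chilbert_space) set" where
  "H10_space T = {f. \<exists>f'. has_H10_deriv T f f'}"

definition continuous_rep ::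
    "real \<Rightarrow> (real \<Rightarrow> 'a::chilbert_space) \<Rightarrow> (real \<Rightarrow> 'a) \<Rightarrow> bool" where
  "continuous_rep T f h \<longleftrightarrow>
     continuous_on {0..T} h \<and> (AE t in interval_measure T. h t = f t)"

section \<open>Control systems\<close>

text \<open>Mild solution of \<open>i u\<^sub>t + L u = h\<close>, \<open>u(0) = 0\<close> on \<open>[0,T]\<close>, where \<open>L\<close> has domain \<open>D\<close>:
  the equation integrated over \<open>[0,t]\<close>.\<close>

definition mild_solution ::
    "'h::chilbert_space set \<Rightarrow> ('h \<Rightarrow> 'h) \<Rightarrow> real \<Rightarrow> (real \<Rightarrow> 'h) \<Rightarrow> (real \<Rightarrow> 'h) \<Rightarrow> bool" where
  "mild_solution D L T h u \<longleftrightarrow>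
     continuous_on {0..T} u \<and> u 0 = 0 \<and>
     (\<forall>t\<in>{0..T}. integral {0..t} u \<in> D \<and>
        (h has_integral (\<i> *\<^sub>C u t + L (integral {0..t} u))) {0..t})"

text \<open>The systems \<open>i u\<^sub>t - A u = B f\<close> and \<open>i v\<^sub>t + A\<^sup>* v = - B g\<close>.\<close>

definition control_solution ::
    "'h::chilbert_space set \<Rightarrow> ('h \<Rightarrow> 'h) \<Rightarrow> ('y::chilbert_space \<Rightarrow> 'h) \<Rightarrow> real \<Rightarrow>
     (real \<Rightarrow> 'y) \<Rightarrow> (real \<Rightarrow> 'h) \<Rightarrow> bool" where
  "control_solution D A B T f u \<longleftrightarrow> mild_solution D (\<lambda>x. - A x) T (\<lambda>t. B (f t)) u"

definition adj_control_solution ::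
    "'h::chilbert_space set \<Rightarrow> ('h \<Rightarrow> 'h) \<Rightarrow> ('y::chilbert_space \<Rightarrow> 'h) \<Rightarrow> real \<Rightarrow>
     (real \<Rightarrow> 'y) \<Rightarrow> (real \<Rightarrow> 'h) \<Rightarrow> bool" where
  "adj_control_solution D A B T g v \<longleftrightarrow>
     mild_solution (adj_dom D A) (adj_op D A) T (\<lambda>t. - B (g t)) v"

definition well_posed ::
    "real \<Rightarrow> ((real \<Rightarrow> 'y::chilbert_space) \<Rightarrow> (real \<Rightarrow> 'h::chilbert_space) \<Rightarrow> bool) \<Rightarrow> bool" where
  "well_posed T sol \<longleftrightarrow>
     (\<forall>f\<in>L2_space T. \<exists>u. sol f u \<and> (\<forall>u'. sol f u' \<longrightarrow> (\<forall>t\<in>{0..T}. u' t = u t)))"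

definition control_op ::
    "'h::chilbert_space set \<Rightarrow> ('h \<Rightarrow> 'h) \<Rightarrow> ('y::chilbert_space \<Rightarrow> 'h) \<Rightarrow> real \<Rightarrow>
     (real \<Rightarrow> 'y) \<Rightarrow> 'h" where
  "control_op D A B T f = (THE x. \<exists>u. control_solution D A B T f u \<and> x = u T)"

definition adj_control_op ::
    "'h::chilbert_space set \<Rightarrow> ('h \<Rightarrow> 'h) \<Rightarrow> ('y::chilbert_space \<Rightarrow> 'h) \<Rightarrow> real \<Rightarrow>
     (real \<Rightarrow> 'y) \<Rightarrow> 'h" where
  "adj_control_op D A B T g = (THE x. \<exists>v. adj_control_solution D A B T g v \<and> x = v T)"

text \<open>The next two conditions determine \<open>C f\<close> and \<open>C' g\<close> up to equality almost everywhere, for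
  \<open>f\<close> and \<open>g\<close> in \<open>L\<^sup>2((0,T); Y)\<close>.\<close>

definition connecting_operator ::
    "'h::chilbert_space set \<Rightarrow> ('h \<Rightarrow> 'h) \<Rightarrow> ('y::chilbert_space \<Rightarrow> 'h) \<Rightarrow> real \<Rightarrow>
     ((real \<Rightarrow> 'y) \<Rightarrow> real \<Rightarrow> 'y) \<Rightarrow> bool" where
  "connecting_operator D A B T C \<longleftrightarrow>
     (\<forall>f\<in>L2_space T. C f \<in> L2_space T) \<and>
     (\<forall>f\<in>L2_space T. \<forall>g\<in>L2_space T.
        L2_inner T (C f) g = cinner (control_op D A B T f) (adj_control_op D A B T g))"

definition is_L2_adjoint ::
    "real \<Rightarrow> ((real \<Rightarrow> 'y::chilbert_space) \<Rightarrow> real \<Rightarrow> 'y) \<Rightarrow>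
     ((real \<Rightarrow> 'y) \<Rightarrow> real \<Rightarrow> 'y) \<Rightarrow> bool" where
  "is_L2_adjoint T C C' \<longleftrightarrow>
     (\<forall>g\<in>L2_space T. C' g \<in> L2_space T) \<and>
     (\<forall>f\<in>L2_space T. \<forall>g\<in>L2_space T. L2_inner T (C f) g = L2_inner T f (C' g))"

text \<open>\<open>f\<close> in \<open>H\<^sub>0\<^sup>1\<close> solves \<open>K f' + \<mu> K f = 0\<close>.  Solutions are understood modulo
  the kernel of \<open>K\<close>: as \<open>C\<^sup>T\<close> may have a kernel containing some nonzero \<open>f\<close> together with its
  derivative, asking only for \<open>f \<noteq> 0\<close> would make every \<open>\<mu>\<close> an eigenvalue.\<close>

definition solves_gen_spectral ::
    "real \<Rightarrow> ((real \<Rightarrow> 'y::chilbert_space) \<Rightarrow> real \<Rightarrow> 'y) \<Rightarrow> complex \<Rightarrow> (real \<Rightarrow> 'y) \<Rightarrow> bool" where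
  "solves_gen_spectral T K \<mu> f \<longleftrightarrow>
     \<not> (AE t in interval_measure T. K f t = 0) \<and>
     (\<exists>f'. has_H10_deriv T f f' \<and>
           (AE t in interval_measure T. K f' t + \<mu> *\<^sub>C K f t = 0))"

end

(* Pairing the controlled state with an eigenvector of the adjoint problem and solving the resulting
   scalar equation turns (W f, psi_k) into the L2 moment of f against an exponential times O psi_k,
   and likewise for (W' g, phi_k).  Two consequences:

   - since f vanishes at 0 and T, integration by parts gives (W f', psi_k) = - i lam_k (W f, psi_k);
     the psi_k lie in the range of W' and are total, so C f' + i mu C f = 0 says exactly that
     (mu - lam_k) (W f, psi_k) = 0 for all k, i.e. that W f = 0, or mu is some lam_k and W f is a
     multiple of phi_k;

   - if W f is an eigenvector for lam_k, then (C f, g) = (W f, W' g) is, for every g, the pairing of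
     - i exp(i lam_k (t - T)) O W f with g, so this function is C f.

   The adjoint C' is treated in the same way, with the roles of W and W' interchanged. *)

theory Submission
  imports Defs
begin

text \<open>Neither \<open>C\<close> nor the control operators are given as linear maps:
  \<open>C f\<close> is known only through its pairings, and \<open>W f\<close> is a definite
  description. Every identity is therefore proved weakly: between square-integrable functions by
  pairing with all of \<open>L2_space T\<close>, between states by pairing with one of the two Riesz
  bases. Totality and biorthogonality of the bases thus replace any expansion in series.

  The state equation is available only in integrated form, and derivatives of controls are merely
  square-integrable, so the scalar equation cannot be differentiated pointwise and solved with an
  integrating factor. Instead the exponential weight is moved by an integration by parts valid for
  primitives of absolutely integrable functions. It is used twice, and the unwanted integrals
  cancel.

  The control space may be nonseparable. Borel measurability is therefore invoked only after passing
  to scalar functions; before that, approximating simple functions are handled directly.\<close>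

instance chilbert_space \<subseteq> banach ..

section \<open>Complex Hilbert spaces\<close>

lemma cinner_add_right: "cinner x (y + z) = cinner x y + cinner x z"
  by (metis cinner_commute cinner_add_left complex_cnj_add)

lemma cinner_scaleC_right: "cinner x (a *\<^sub>C y) = cnj a * cinner x y"
  by (metis cinner_commute cinner_scaleC_left complex_cnj_mult)

lemma cinner_scaleR_left: "cinner (r *\<^sub>R x) y = of_real r * cinner x y"
  by (metis cinner_scaleC_left scaleC_of_real)

lemma cinner_minus_left: "cinner (- x) y = - cinner x y"
  using cinner_scaleR_left[of "-1" x y] by simp

lemma cinner_diff_left: "cinner (x - y) z = cinner x z - cinner y z"
  using cinner_add_left[of x "-y" z] by (simp add: cinner_minus_left)

lemma cinner_zero_left [simp]: "cinner 0 x = 0"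
  using cinner_diff_left[of x x x] by simp

lemma scaleC_zero_right [simp]: "a *\<^sub>C 0 = 0"
  using scaleC_add_right[of a 0 0] by simp

lemma scaleC_one [simp]: "1 *\<^sub>C x = x"
  using scaleC_of_real[of 1 x] by simp

lemma cinner_self: "cinner x x = of_real ((norm x)\<^sup>2)"
proof (rule complex_eqI)
  show "Im (cinner x x) = Im (of_real ((norm x)\<^sup>2))"
    using arg_cong[OF cinner_commute[of x x], of Im] by simp
qed (simp add: Re_cinner power2_norm_eq_inner)

lemma cinner_eq_zero_iff: "cinner x x = 0 \<longleftrightarrow> x = 0"
  by (simp add: cinner_self)

text \<open>The class ties the norm to the real inner product only. Compatibility with complex
  scalars comes from evaluating the complex form on the diagonal, where it is the squared
  norm.\<close>

lemma norm_scaleC: "norm (a *\<^sub>C x) = cmod a * norm x"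
proof -
  have "complex_of_real ((norm (a *\<^sub>C x))\<^sup>2) = cinner (a *\<^sub>C x) (a *\<^sub>C x)"
    by (simp only: cinner_self)
  also have "\<dots> = (a * cnj a) * cinner x x"
    by (simp add: cinner_scaleC_left cinner_scaleC_right)
  also have "\<dots> = of_real ((cmod a * norm x)\<^sup>2)"
    by (simp only: cinner_self complex_norm_square[symmetric] power_mult_distrib of_real_mult of_real_power)
  finally have "complex_of_real ((norm (a *\<^sub>C x))\<^sup>2) = of_real ((cmod a * norm x)\<^sup>2)" .
  then have "(norm (a *\<^sub>C x))\<^sup>2 = (cmod a * norm x)\<^sup>2"
    using of_real_eq_iff by blast
  then show ?thesis
    by (simp add: power2_eq_iff_nonneg)
qed

lemma scaleC_eq_zero_iff: "a *\<^sub>C x = 0 \<longleftrightarrow> a = 0 \<or> x = 0"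
  by (metis norm_scaleC norm_eq_zero mult_eq_0_iff)

text \<open>The real Cauchy-Schwarz inequality bounds the real part, and the imaginary part is the
  real part after rotating \<open>x\<close> by \<open>- \<i>\<close>. Adding the two costs the
  factor 2, harmless because only continuity and integrability are drawn from the bound.\<close>

lemma cmod_cinner_le: "cmod (cinner x y) \<le> 2 * (norm x * norm y)"
proof -
  have "\<bar>Re (cinner x y)\<bar> \<le> norm x * norm y"
    by (simp add: Re_cinner Cauchy_Schwarz_ineq2)
  moreover have "Re (cinner (- \<i> *\<^sub>C x) y) = Im (cinner x y)"
    by (simp add: cinner_scaleC_left)
  then have "\<bar>Im (cinner x y)\<bar> \<le> norm x * norm y"
    using Cauchy_Schwarz_ineq2[of "- \<i> *\<^sub>C x" y] by (simp add: Re_cinner norm_scaleC)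
  ultimately show ?thesis
    using cmod_le[of "cinner x y"] by linarith
qed

lemma bounded_bilinear_cinner: "bounded_bilinear cinner"
proof
  show "\<exists>K. \<forall>x y. norm (cinner x y) \<le> norm x * norm y * K"
    by (rule exI[of _ 2]) (metis cmod_cinner_le mult.commute)
  show "cinner x (r *\<^sub>R y) = r *\<^sub>R cinner x y" for r and x y :: 'a
    by (metis cinner_scaleC_right complex_cnj_complex_of_real scaleC_of_real scaleR_conv_of_real)
qed (simp_all add: cinner_add_left cinner_add_right cinner_scaleR_left scaleR_conv_of_real)

lemma bounded_bilinear_scaleC: "bounded_bilinear (*\<^sub>C)"
proof
  show "(r *\<^sub>R a) *\<^sub>C x = r *\<^sub>R (a *\<^sub>C x)" for r a and x :: 'a
    by (metis scaleC_of_real scaleC_scaleC scaleR_conv_of_real)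
  show "a *\<^sub>C (r *\<^sub>R x) = r *\<^sub>R (a *\<^sub>C x)" for r a and x :: 'a
    by (metis scaleC_of_real scaleC_scaleC mult.commute)
  show "\<exists>K. \<forall>a (x::'a). norm (a *\<^sub>C x) \<le> norm a * norm x * K"
    by (rule exI[of _ 1]) (simp add: norm_scaleC)
qed (simp_all add: scaleC_add_left scaleC_add_right)

lemmas bounded_linear_cinner_left = bounded_bilinear.bounded_linear_left[OF bounded_bilinear_cinner]

lemma scaleC_minus_left: "(- a) *\<^sub>C x = - (a *\<^sub>C x)"
  using bounded_bilinear.minus_left[OF bounded_bilinear_scaleC] by blast

text \<open>Boundedness of \<open>V\<close> makes the set of \<open>y\<close> with
  \<open>V y\<close> orthogonal to \<open>x\<close> closed, so it contains the closed span of
  \<open>e\<close>, which is everything. Surjectivity of \<open>V\<close> then allows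
  \<open>V y = x\<close>.\<close>

lemma riesz_basis_total:
  fixes x :: "'a::chilbert_space"
  assumes "riesz_basis \<phi>" and ortho: "\<And>k. cinner x (\<phi> k) = 0"
  shows "x = 0"
proof -
  obtain e :: "nat \<Rightarrow> 'a" and V where e: "orthonormal_basis e" and V: "bounded_clinear V" "bij V"
    and \<phi>: "\<And>k. \<phi> k = V (e k)"
    using assms(1) unfolding riesz_basis_def by blast
  have blV: "bounded_linear V" and VC: "\<And>a y. V (a *\<^sub>C y) = a *\<^sub>C V y"
    using V unfolding bounded_clinear_def by auto
  let ?S = "{y. cinner x (V y) = 0}"
  have "continuous_on UNIV (\<lambda>y. cinner x (V y))"
    by (intro bounded_bilinear.continuous_on[OF bounded_bilinear_cinner]
        bounded_linear.continuous_on[OF blV] continuous_intros)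
  then have "closed ?S"
    using closed_Collect_eq[of "\<lambda>y. cinner x (V y)" "\<lambda>_. 0"] by simp
  moreover have "(\<Sum>k<n. c k *\<^sub>C e k) \<in> ?S" for n c
    by (simp add: linear_sum[OF bounded_linear.linear[OF blV]] VC
        bounded_bilinear.sum_right[OF bounded_bilinear_cinner] cinner_scaleC_right ortho flip: \<phi>)
  ultimately have "closure {\<Sum>k<n. c k *\<^sub>C e k | (n::nat) c. True} \<subseteq> ?S"
    by (intro closure_minimal) auto
  then have "cinner x (V y) = 0" for y
    using e unfolding orthonormal_basis_def by auto
  then have "cinner x x = 0"
    using V(2) by (metis bij_pointE)
  then show ?thesis
    by (simp add: cinner_eq_zero_iff)
qed

lemma cinner_ext_dense:
  assumes "closure D = UNIV" and "\<And>x. x \<in> D \<Longrightarrow> cinner x y = cinner x z"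
  shows "y = z"
proof -
  let ?S = "{x. cinner x (y - z) = 0}"
  have "continuous_on UNIV (\<lambda>x. cinner x (y - z))"
    by (intro bounded_bilinear.continuous_on[OF bounded_bilinear_cinner] continuous_intros)
  then have "closed ?S"
    using closed_Collect_eq[of "\<lambda>x. cinner x (y - z)" "\<lambda>_. 0"] by simp
  moreover have "D \<subseteq> ?S"
    using assms(2) by (auto simp: bounded_bilinear.diff_right[OF bounded_bilinear_cinner])
  ultimately have "closure D \<subseteq> ?S"
    by (rule closure_minimal[rotated])
  then have "cinner (y - z) (y - z) = 0"
    using assms(1) by auto
  then show ?thesis
    by (simp add: cinner_eq_zero_iff)
qed

text \<open>Density of the domain makes the vector \<open>z\<close> unique, so that the definite
  description in \<open>adj_op\<close> denotes it.\<close>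

lemma cinner_adj_op:
  assumes "densely_defined_operator D A" "x \<in> D" "y \<in> adj_dom D A"
  shows "cinner (A x) y = cinner x (adj_op D A y)"
proof -
  obtain z where z: "\<forall>x\<in>D. cinner (A x) y = cinner x z"
    using assms(3) unfolding adj_dom_def by blast
  have "w = z" if "\<forall>x\<in>D. cinner (A x) y = cinner x w" for w
    using cinner_ext_dense[of D w z] assms(1) z that unfolding densely_defined_operator_def by simp
  then have "adj_op D A y = z"
    unfolding adj_op_def using z by (intro the_equality) auto
  then show ?thesis
    using z assms(2) by simp
qed

section \<open>Square-integrable functions\<close>

text \<open>Lebesgue measure is complete. Multiplying by the indicator of \<open>S\<close> carries
  the claim over to the whole space, where completeness applies.\<close>

lemma borel_measurable_AE_lebesgue_on:
  fixes f g :: "'a::euclidean_space \<Rightarrow> 'b::euclidean_space"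
  assumes f: "f \<in> borel_measurable (lebesgue_on S)" and S: "S \<in> sets lebesgue"
    and ae: "AE x in lebesgue_on S. f x = g x"
  shows "g \<in> borel_measurable (lebesgue_on S)"
proof -
  have "(\<lambda>x. indicat_real S x *\<^sub>R f x) \<in> borel_measurable lebesgue"
    using f S by (simp add: borel_measurable_restrict_space_iff)
  moreover have "AE x in lebesgue. indicat_real S x *\<^sub>R f x = indicat_real S x *\<^sub>R g x"
    using ae S by (auto simp: AE_restrict_space_iff indicator_def elim: eventually_mono)
  ultimately have "(\<lambda>x. indicat_real S x *\<^sub>R g x) \<in> borel_measurable lebesgue"
    by (rule borel_measurable_AE)
  then show ?thesis
    using S by (simp add: borel_measurable_restrict_space_iff)
qed

lemma strongly_measurable_imp_borel:
  fixes f :: "'a::euclidean_space \<Rightarrow> 'b::euclidean_space"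
  assumes f: "strongly_measurable (lebesgue_on S) f" and S: "S \<in> sets lebesgue"
  shows "f \<in> borel_measurable (lebesgue_on S)"
proof -
  let ?M = "lebesgue_on S"
  obtain s where s: "\<And>n::nat. simple_function ?M (s n)" and lim: "AE t in ?M. (\<lambda>n. s n t) \<longlonglongrightarrow> f t"
    using f unfolding strongly_measurable_def by blast
  obtain N where N: "N \<in> null_sets ?M" "\<And>t. t \<in> space ?M - N \<Longrightarrow> (\<lambda>n. s n t) \<longlonglongrightarrow> f t"
    using AE_E3[OF lim] by blast
  \<comment> \<open>Setting the function and its approximants to zero on the exceptional null set
    turns convergence almost everywhere into convergence everywhere.\<close>
  define g where "g = (\<lambda>t. if t \<in> N then 0 else f t)"
  have "g \<in> borel_measurable ?M"
  proof (rule borel_measurable_LIMSEQ_metric)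
    show "(\<lambda>t. if t \<in> N then 0 else s n t) \<in> borel_measurable ?M" for n
      using N(1) s by (intro measurable_If_set borel_measurable_simple_function) auto
    show "(\<lambda>n. if t \<in> N then 0 else s n t) \<longlonglongrightarrow> g t" if "t \<in> space ?M" for t
      using N(2) that by (auto simp: g_def)
  qed
  moreover have "AE t in ?M. g t = f t"
    using AE_not_in[OF N(1)] by eventually_elim (simp add: g_def)
  ultimately show ?thesis
    using borel_measurable_AE_lebesgue_on[OF _ S] by blast
qed

text \<open>Composing the approximating simple functions avoids a product sigma-algebra, which
  behaves badly on nonseparable spaces; joint sequential continuity of \<open>h\<close> is
  enough.\<close>

lemma strongly_measurable_compose2:
  assumes f: "strongly_measurable M f" and g: "strongly_measurable M g"
    and h: "\<And>a b u v. u \<longlonglongrightarrow> a \<Longrightarrow> v \<longlonglongrightarrow> b \<Longrightarrow> (\<lambda>n::nat. h (u n) (v n)) \<longlonglongrightarrow> h a b"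
  shows "strongly_measurable M (\<lambda>t. h (f t) (g t))"
proof -
  obtain r where r: "\<And>n::nat. simple_function M (r n)" "AE t in M. (\<lambda>n. r n t) \<longlonglongrightarrow> f t"
    using f unfolding strongly_measurable_def by blast
  obtain s where s: "\<And>n::nat. simple_function M (s n)" "AE t in M. (\<lambda>n. s n t) \<longlonglongrightarrow> g t"
    using g unfolding strongly_measurable_def by blast
  have "AE t in M. (\<lambda>n. h (r n t) (s n t)) \<longlonglongrightarrow> h (f t) (g t)"
    using r(2) s(2) by eventually_elim (rule h)
  then show ?thesis
    unfolding strongly_measurable_def
    by (intro exI[of _ "\<lambda>n t. h (r n t) (s n t)"])
       (auto intro!: simple_function_compose2[where h=h] r s)
qed

lemma strongly_measurable_continuous:
  fixes f :: "real \<Rightarrow> 'a::metric_space"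
  assumes T: "T > 0" and f: "continuous_on {0..T} f"
  shows "strongly_measurable (interval_measure T) f"
proof -
  \<comment> \<open>\<open>p n t\<close> is the largest multiple of \<open>T / (n + 1)\<close> not
    exceeding \<open>t\<close>. It takes finitely many values on the interval, so sampling
    \<open>f\<close> there yields simple functions.\<close>
  define p where "p = (\<lambda>(n::nat) t. T * of_int \<lfloor>(of_nat n + 1) * t / T\<rfloor> / (of_nat n + 1))"
  have p: "p n t \<le> t" "t - T / (of_nat n + 1) \<le> p n t" for n t
  proof -
    define x where "x = (of_nat n + 1) * t / T"
    have x: "t = T * x / (of_nat n + 1)" "p n t = T * of_int \<lfloor>x\<rfloor> / (of_nat n + 1)"
      using T by (simp_all add: x_def p_def)
    have "T * of_int \<lfloor>x\<rfloor> \<le> T * x" "T * (x - 1) \<le> T * of_int \<lfloor>x\<rfloor>"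
      using T by (intro mult_left_mono; linarith)+
    then have "T * of_int \<lfloor>x\<rfloor> / (of_nat n + 1) \<le> T * x / (of_nat n + 1)"
      "T * (x - 1) / (of_nat n + 1) \<le> T * of_int \<lfloor>x\<rfloor> / (of_nat n + 1)"
      by (intro divide_right_mono; simp)+
    then show "p n t \<le> t" "t - T / (of_nat n + 1) \<le> p n t"
      using x by (simp_all add: right_diff_distrib diff_divide_distrib)
  qed
  have p0: "0 \<le> p n t" if "0 < t" for n t
    using T that by (auto simp: p_def)
  have lim: "(\<lambda>n. p n t) \<longlonglongrightarrow> t" for t
  proof (rule tendsto_sandwich[of "\<lambda>n. t - T / (of_nat n + 1)" _ _ "\<lambda>_. t"])
    have "(\<lambda>n. t - T * inverse (real (Suc n))) \<longlonglongrightarrow> t - T * 0"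
      by (intro tendsto_intros LIMSEQ_inverse_real_of_nat)
    then show "(\<lambda>n. t - T / (real n + 1)) \<longlonglongrightarrow> t"
      by (simp add: divide_inverse add.commute)
  qed (use p in auto)
  have fin: "finite (p n ` {0<..<T})" for n
  proof (rule finite_subset)
    show "p n ` {0<..<T} \<subseteq> (\<lambda>i. T * of_int i / (of_nat n + 1)) ` {0..int n + 1}"
    proof (rule image_subsetI)
      fix t assume t: "t \<in> {0<..<T}"
      have "(of_nat n + 1) * t / T \<le> of_nat n + 1" "0 \<le> (of_nat n + 1) * t / T"
        using t mult_left_mono[of t T "of_nat n + 1"] by (auto simp: divide_le_eq)
      then have "\<lfloor>(of_nat n + 1) * t / T\<rfloor> \<in> {0..int n + 1}"
        by (auto simp: floor_le_iff)
      then show "p n t \<in> (\<lambda>i. T * of_int i / (of_nat n + 1)) ` {0..int n + 1}"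
        unfolding p_def by (rule imageI[where f="\<lambda>i. T * of_int i / (of_nat n + 1)"])
    qed
  qed simp
  have "p n \<in> borel_measurable borel" for n
    unfolding p_def by measurable
  then have "p n \<in> borel_measurable (interval_measure T)" for n
    by (simp add: measurable_completion measurable_restrict_space1)
  then have "simple_function (interval_measure T) (p n)" for n
    using fin by (intro simple_function_borel_measurable) (auto simp: space_restrict_space)
  then have "simple_function (interval_measure T) (\<lambda>t. f (p n t))" for n
    by (rule simple_function_compose1)
  moreover have "(\<lambda>n. f (p n t)) \<longlonglongrightarrow> f t" if "t \<in> {0<..<T}" for t
  proof (rule continuous_on_tendsto_compose[OF f lim])
    have "p n t \<in> {0..T}" for n
      using p(1)[of n t] p0[of t n] that by auto
    then show "\<forall>\<^sub>F n in sequentially. p n t \<in> {0..T}" by simp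
  qed (use that in auto)
  ultimately show ?thesis
    unfolding strongly_measurable_def
    by (intro exI[of _ "\<lambda>n t. f (p n t)"]) (auto intro!: AE_I2 simp: space_restrict_space)
qed

section \<open>Membership in L^2 and the L^2 pairing\<close>

lemma L2_continuous:
  assumes T: "T > 0" and f: "continuous_on {0..T} f"
  shows "f \<in> L2_space T"
proof -
  have c: "continuous_on {0..T} (\<lambda>t. (norm (f t))\<^sup>2)"
    using f by (intro continuous_intros)
  then have "(\<lambda>t. (norm (f t))\<^sup>2) absolutely_integrable_on {0..T}"
    using absolutely_integrable_continuous_real by blast
  then have "(\<lambda>t. (norm (f t))\<^sup>2) absolutely_integrable_on {0<..<T}"
    by (simp add: absolutely_integrable_on_Icc_iff_Ioo)
  then have "integrable (interval_measure T) (\<lambda>t. (norm (f t))\<^sup>2)"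
    by (simp add: integrable_restrict_space set_integrable_def)
  then show ?thesis
    using strongly_measurable_continuous[OF T f] by (simp add: L2_space_def)
qed

lemma L2_cinner_integrable:
  assumes f: "f \<in> L2_space T" and g: "g \<in> L2_space T"
  shows "integrable (interval_measure T) (\<lambda>t. cinner (f t) (g t))"
proof (rule Bochner_Integration.integrable_bound)
  show "integrable (interval_measure T) (\<lambda>t. (norm (f t))\<^sup>2 + (norm (g t))\<^sup>2)"
    using f g by (auto simp: L2_space_def)
  have "strongly_measurable (interval_measure T) (\<lambda>t. cinner (f t) (g t))"
    by (rule strongly_measurable_compose2[where h=cinner])
      (use f g in \<open>simp_all add: L2_space_def bounded_bilinear.tendsto[OF bounded_bilinear_cinner]\<close>)
  then show "(\<lambda>t. cinner (f t) (g t)) \<in> borel_measurable (interval_measure T)"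
    by (rule strongly_measurable_imp_borel) simp
  have "cmod (cinner (f t) (g t)) \<le> (norm (f t))\<^sup>2 + (norm (g t))\<^sup>2" for t
    using cmod_cinner_le[of "f t" "g t"] sum_squares_bound[of "norm (f t)" "norm (g t)"]
    by (simp add: mult.assoc)
  then show "AE t in interval_measure T. norm (cinner (f t) (g t)) \<le> norm ((norm (f t))\<^sup>2 + (norm (g t))\<^sup>2)"
    by simp
qed

lemma L2_add_scaleC:
  assumes f: "f \<in> L2_space T" and g: "g \<in> L2_space T"
  shows "(\<lambda>t. f t + a *\<^sub>C g t) \<in> L2_space T"
proof -
  let ?M = "interval_measure T"
  have sm: "strongly_measurable ?M (\<lambda>t. f t + a *\<^sub>C g t)"
    by (rule strongly_measurable_compose2[where h="\<lambda>x y. x + a *\<^sub>C y"])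
      (use f g in \<open>simp_all add: L2_space_def tendsto_add
        bounded_bilinear.tendsto[OF bounded_bilinear_scaleC tendsto_const]\<close>)
  have "strongly_measurable ?M (\<lambda>t. (norm (f t + a *\<^sub>C g t))\<^sup>2)"
    \<comment> \<open>The second argument is a dummy: the two-variable rule serves for a function of
      one variable.\<close>
    by (rule strongly_measurable_compose2[OF sm sm, where h="\<lambda>x _. (norm x)\<^sup>2"]) (intro tendsto_intros)
  then have "(\<lambda>t. (norm (f t + a *\<^sub>C g t))\<^sup>2) \<in> borel_measurable ?M"
    by (rule strongly_measurable_imp_borel) simp
  moreover have "integrable ?M (\<lambda>t. 2 * (norm (f t))\<^sup>2 + 2 * (cmod a)\<^sup>2 * (norm (g t))\<^sup>2)"
    using f g by (auto simp: L2_space_def)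
  moreover have "(norm (f t + a *\<^sub>C g t))\<^sup>2 \<le> 2 * (norm (f t))\<^sup>2 + 2 * (cmod a)\<^sup>2 * (norm (g t))\<^sup>2" for t
  proof -
    have "(norm (f t + a *\<^sub>C g t))\<^sup>2 \<le> (norm (f t) + cmod a * norm (g t))\<^sup>2"
      by (intro power_mono order_trans[OF norm_triangle_ineq]) (auto simp: norm_scaleC)
    also have "\<dots> \<le> 2 * (norm (f t))\<^sup>2 + 2 * (cmod a * norm (g t))\<^sup>2"
      using sum_squares_bound[of "norm (f t)" "cmod a * norm (g t)"] by (simp add: power2_sum)
    finally show ?thesis by (simp add: power_mult_distrib)
  qed
  ultimately have "integrable ?M (\<lambda>t. (norm (f t + a *\<^sub>C g t))\<^sup>2)"
    by (elim Bochner_Integration.integrable_bound) (auto intro!: AE_I2)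
  with sm show ?thesis
    by (simp add: L2_space_def)
qed

lemma L2_scaleC:
  assumes "T > 0" "f \<in> L2_space T"
  shows "(\<lambda>t. a *\<^sub>C f t) \<in> L2_space T"
  using L2_add_scaleC[OF L2_continuous[of T "\<lambda>_. 0"] assms(2), of a] assms(1) by simp

lemma L2_inner_commute: "L2_inner T f g = cnj (L2_inner T g f)"
proof -
  have "L2_inner T f g = (\<integral>t. cnj (cinner (g t) (f t)) \<partial>interval_measure T)"
    unfolding L2_inner_def by (subst cinner_commute) simp
  then show ?thesis
    by (simp add: L2_inner_def)
qed

lemma L2_inner_add_scaleC_left:
  assumes "f \<in> L2_space T" "g \<in> L2_space T" "h \<in> L2_space T"
  shows "L2_inner T (\<lambda>t. f t + a *\<^sub>C g t) h = L2_inner T f h + a * L2_inner T g h"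
  unfolding L2_inner_def cinner_add_left cinner_scaleC_left
  using assms by (simp add: L2_cinner_integrable)

lemma L2_inner_scaleC_left: "L2_inner T (\<lambda>t. a *\<^sub>C g t) h = a * L2_inner T g h"
  by (simp add: L2_inner_def cinner_scaleC_left)

lemma L2_inner_AE_zero:
  assumes "AE t in interval_measure T. f t = 0"
  shows "L2_inner T f g = 0"
  unfolding L2_inner_def
  by (rule integral_eq_zero_AE) (use assms in \<open>eventually_elim, simp\<close>)

text \<open>Testing with \<open>g = f\<close> gives the vanishing of the integral of the squared
  norm.\<close>

lemma L2_AE_zeroI:
  assumes f: "f \<in> L2_space T" and "\<And>g. g \<in> L2_space T \<Longrightarrow> L2_inner T f g = 0"
  shows "AE t in interval_measure T. f t = 0"
proof -
  have "complex_of_real (\<integral>t. (norm (f t))\<^sup>2 \<partial>interval_measure T) = L2_inner T f f"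
    by (simp add: L2_inner_def cinner_self flip: integral_complex_of_real)
  then have "(\<integral>t. (norm (f t))\<^sup>2 \<partial>interval_measure T) = 0"
    using assms by simp
  then have "AE t in interval_measure T. (norm (f t))\<^sup>2 = 0"
    using f by (subst (asm) integral_nonneg_eq_0_iff_AE) (auto simp: L2_space_def)
  then show ?thesis
    by simp
qed

lemma L2_AE_eqI:
  assumes f: "f \<in> L2_space T" and g: "g \<in> L2_space T"
    and "\<And>h. h \<in> L2_space T \<Longrightarrow> L2_inner T f h = L2_inner T g h"
  shows "AE t in interval_measure T. f t = g t"
proof -
  have "AE t in interval_measure T. f t + (-1) *\<^sub>C g t = 0"
    using assms by (intro L2_AE_zeroI L2_add_scaleC) (simp_all add: L2_inner_add_scaleC_left)
  then show ?thesis
    by (simp add: scaleC_minus_left)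
qed

lemma L2_inner_eq_integral:
  assumes "f \<in> L2_space T" "g \<in> L2_space T"
  shows "L2_inner T f g = integral {0..T} (\<lambda>t. cinner (f t) (g t))"
  unfolding L2_inner_def integral_open_interval_real
  using L2_cinner_integrable[OF assms] by (rule lebesgue_integral_eq_integral) simp

lemma L2_cinner_absolutely_integrable:
  assumes "f \<in> L2_space T" "g \<in> L2_space T"
  shows "(\<lambda>t. cinner (f t) (g t)) absolutely_integrable_on {0..T}"
  unfolding absolutely_integrable_on_Icc_iff_Ioo
  using L2_cinner_integrable[OF assms] by (simp add: integrable_restrict_space set_integrable_def)

text \<open>The points of the open interval where the functions differ form an open null set, hence
  none; the endpoints follow by continuity. This gives the value at \<open>T\<close> a meaning in
  the trace formulas.\<close>

lemma continuous_AE_eq_on_interval: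
  fixes f g :: "real \<Rightarrow> 'a::real_normed_vector"
  assumes T: "T > 0" and f: "continuous_on {0..T} f" and g: "continuous_on {0..T} g"
    and ae: "AE t in interval_measure T. f t = g t" and t: "t \<in> {0..T}"
  shows "f t = g t"
proof -
  let ?d = "\<lambda>t. f t - g t"
  have c: "continuous_on {0..T} ?d"
    using f g by (intro continuous_intros)
  let ?U = "{0<..<T} \<inter> ?d -` (- {0})"
  have "open ?U"
    by (rule continuous_open_preimage) (auto intro: continuous_on_subset[OF c])
  moreover have "?U \<in> null_sets lebesgue"
    using ae by (auto simp: AE_restrict_space_iff completion.AE_iff_null_sets elim!: back_subst[of "\<lambda>S. S \<in> null_sets lebesgue"])
  then have "negligible ?U"
    by (simp add: negligible_iff_null_sets)
  ultimately have "?U = {}"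
    using open_not_negligible by blast
  then have "?d s = 0" if "s \<in> {0<..<T}" for s
    using that by auto
  moreover have "closure {0<..<T} = {0..T}"
    using T by simp
  ultimately have "?d t = 0"
    using continuous_constant_on_closure[of "{0<..<T}" ?d 0 t] c t by simp
  then show ?thesis by simp
qed

section \<open>Integration by parts\<close>

text \<open>The difference of the two sides, with upper limit \<open>t\<close>, has derivative zero: its increment
  over \<open>[x, y]\<close> is at most a constant times \<open>(y - x)\<close> times the integral of \<open>norm h\<close> over
  \<open>[x, y]\<close>.  Thus \<open>h\<close> need not be continuous anywhere.\<close>

lemma integral_by_parts_absolutely_integrable:
  fixes h F e e' :: "real \<Rightarrow> complex"
  assumes T: "0 \<le> T" and h: "h absolutely_integrable_on {0..T}"
    and F: "\<And>t. t \<in> {0..T} \<Longrightarrow> (h has_integral F t) {0..t}"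
    and e: "\<And>t. t \<in> {0..T} \<Longrightarrow> (e has_vector_derivative e' t) (at t within {0..T})"
    and e': "continuous_on {0..T} e'"
  shows "integral {0..T} (\<lambda>t. e t * h t) = e T * F T - integral {0..T} (\<lambda>t. e' t * F t)"
proof -
  have ce: "continuous_on {0..T} e"
    unfolding continuous_on_eq_continuous_within using e has_vector_derivative_continuous by blast
  have hi: "h integrable_on {0..T}" and ni: "(\<lambda>t. norm (h t)) integrable_on {0..T}"
    using h by (auto simp: absolutely_integrable_on_def)
  have F_eq: "F t = integral {0..t} h" if "t \<in> {0..T}" for t
    using F[OF that] by (simp add: integral_unique)
  have cF: "continuous_on {0..T} F"
    using indefinite_integral_continuous_1[OF hi] by (subst continuous_on_cong[OF refl F_eq]) auto
  have mult_int: "(\<lambda>t. c t * h t) absolutely_integrable_on {0..T}" if "continuous_on {0..T} c" for c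
  proof (rule absolutely_integrable_bounded_measurable_product[of "(*)"])
    show "c \<in> borel_measurable (lebesgue_on {0..T})"
      using that by (intro continuous_imp_measurable_on_sets_lebesgue) auto
    show "bounded (c ` {0..T})"
      using that by (intro compact_imp_bounded compact_continuous_image) auto
  qed (use h bilinear_times in auto)
  have ehi: "(\<lambda>t. e t * h t) integrable_on {0..T}"
    using mult_int[OF ce] by (simp add: absolutely_integrable_on_def)
  have eFi: "(\<lambda>t. e' t * F t) integrable_on {0..T}"
    using e' cF by (intro integrable_continuous_real continuous_intros)
  define N where "N t = integral {0..t} (\<lambda>t. norm (h t))" for t
  define G where "G t = integral {0..t} (\<lambda>t. e t * h t) - e t * F t + integral {0..t} (\<lambda>t. e' t * F t)" for t
  obtain L where L: "L > 0" "\<And>t. t \<in> {0..T} \<Longrightarrow> norm (e' t) \<le> L"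
    using compact_imp_bounded[OF compact_continuous_image[OF e']] by (auto simp: bounded_pos)
  have G: "norm (G y - G x) \<le> 2 * L * (y - x) * (N y - N x)" if xy: "0 \<le> x" "x \<le> y" "y \<le> T" for x y
  proof -
    have sub: "{x..y} \<subseteq> {0..T}" using xy by auto
    have incr: "integral {0..y} k - integral {0..x} k = integral {x..y} k"
      if "k integrable_on {0..T}" for k :: "real \<Rightarrow> 'b::banach"
      using Henstock_Kurzweil_Integration.integral_combine[of 0 x y k] xy
        integrable_on_subinterval[OF that, of 0 y]
      by (simp add: algebra_simps)
    have on_xy: "k integrable_on {x..y}" if "k integrable_on {0..T}" for k :: "real \<Rightarrow> 'b::banach"
      using integrable_on_subinterval[OF that, of x y] sub by simp
    have ftc: "(e' has_integral (e r - e x)) {x..r}" if "r \<in> {x..y}" for r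
      using that sub xy by (intro fundamental_theorem_of_calculus has_vector_derivative_within_subset[OF e]) auto
    have e_lip: "norm (e r - e x) \<le> L * (y - x)" if "r \<in> {x..y}" for r
    proof -
      have "norm (e r - e x) \<le> L * (r - x)"
        using has_integral_bound_real[OF _ finite.emptyI ftc[OF that], of L] L that sub by auto
      also have "\<dots> \<le> L * (y - x)"
        using L that by (intro mult_left_mono) auto
      finally show ?thesis .
    qed
    have Fr: "norm (F y - F r) \<le> N y - N x" if "r \<in> {x..y}" for r
    proof -
      have "F y - F r = integral {r..y} h"
        using that xy F_eq Henstock_Kurzweil_Integration.integral_combine[of 0 r y h]
          integrable_on_subinterval[OF hi, of 0 y] by (simp add: algebra_simps)
      also have "norm \<dots> \<le> integral {r..y} (\<lambda>t. norm (h t))"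
        using that sub by (intro integral_norm_bound_integral integrable_on_subinterval[OF hi]
            integrable_on_subinterval[OF ni]) auto
      also have "\<dots> \<le> integral {x..y} (\<lambda>t. norm (h t))"
        using that sub by (intro integral_subset_le integrable_on_subinterval[OF ni]) auto
      also have "\<dots> = N y - N x"
        unfolding N_def by (rule incr[OF ni, symmetric])
      finally show ?thesis .
    qed
    have "G y - G x = integral {x..y} (\<lambda>t. e t * h t) - e y * F y + e x * F x + integral {x..y} (\<lambda>t. e' t * F t)"
      unfolding G_def incr[OF ehi, symmetric] incr[OF eFi, symmetric] by simp
    \<comment> \<open>Freezing \<open>e\<close> at the left end and \<open>F\<close> at the right
      end absorbs the boundary terms. Each remaining integral then contains two small quantities:
      the length \<open>y - x\<close> and the increment of \<open>N\<close>.\<close>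
    also have "\<dots> = integral {x..y} (\<lambda>t. (e t - e x) * h t) - integral {x..y} (\<lambda>t. e' t * (F y - F t))"
    proof -
      have "integral {x..y} (\<lambda>t. (e t - e x) * h t) = integral {x..y} (\<lambda>t. e t * h t) - e x * (F y - F x)"
        using on_xy[OF ehi] integrable_on_mult_right[OF on_xy[OF hi], of "e x"] xy F_eq incr[OF hi]
        by (simp add: left_diff_distrib integral_diff)
      moreover have "integral {x..y} (\<lambda>t. e' t * (F y - F t)) = (e y - e x) * F y - integral {x..y} (\<lambda>t. e' t * F t)"
        using on_xy[OF eFi] integrable_on_mult_left[OF has_integral_integrable[OF ftc[of y]], of "F y"]
          integral_unique[OF ftc[of y]] xy
        by (simp add: right_diff_distrib integral_diff)
      ultimately show ?thesis by (simp only: left_diff_distrib[of _ _ "F y"] right_diff_distrib[of "e x"]) simp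
    qed
    also have "norm \<dots> \<le> L * (y - x) * (N y - N x) + L * (y - x) * (N y - N x)"
    proof (rule order_trans[OF norm_triangle_ineq4], rule add_mono)
      have "norm (integral {x..y} (\<lambda>t. (e t - e x) * h t)) \<le> integral {x..y} (\<lambda>t. L * (y - x) * norm (h t))"
      proof (rule integral_norm_bound_integral)
        show "(\<lambda>t. (e t - e x) * h t) integrable_on {x..y}"
          using on_xy[OF ehi] integrable_on_mult_right[OF on_xy[OF hi], of "e x"]
          by (simp add: left_diff_distrib integrable_diff)
        show "(\<lambda>t. L * (y - x) * norm (h t)) integrable_on {x..y}"
          using on_xy[OF ni] by (intro integrable_on_mult_right)
        show "norm ((e t - e x) * h t) \<le> L * (y - x) * norm (h t)" if "t \<in> {x..y}" for t
          using e_lip[OF that] by (simp add: norm_mult mult_right_mono)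
      qed
      also have "\<dots> = L * (y - x) * (N y - N x)"
        unfolding N_def using incr[OF ni] by simp
      finally show "norm (integral {x..y} (\<lambda>t. (e t - e x) * h t)) \<le> L * (y - x) * (N y - N x)" .
      have "norm (integral {x..y} (\<lambda>t. e' t * (F y - F t))) \<le> L * (N y - N x) * (y - x)"
      proof (rule integral_bound)
        show "continuous_on {x..y} (\<lambda>t. e' t * (F y - F t))"
          using e' cF sub by (intro continuous_intros) (auto intro: continuous_on_subset)
        show "norm (e' t * (F y - F t)) \<le> L * (N y - N x)" if "t \<in> {x..y}" for t
          unfolding norm_mult using Fr[OF that] L that sub by (intro mult_mono) auto
      qed (use xy in auto)
      then show "norm (integral {x..y} (\<lambda>t. e' t * (F y - F t))) \<le> L * (y - x) * (N y - N x)"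
        by (simp add: mult_ac)
    qed
    finally show ?thesis by simp
  qed
  have cN: "continuous_on {0..T} N"
    unfolding N_def by (rule indefinite_integral_continuous_1[OF ni])
  have "(G has_derivative (\<lambda>_. 0)) (at x within {0..T})" if x: "x \<in> {0..T}" for x
    unfolding has_derivative_within_alt
  proof (intro conjI allI impI)
    fix \<epsilon> :: real assume "\<epsilon> > 0"
    then have "\<epsilon> / (2 * L) > 0" using L by simp
    then obtain d where d: "d > 0" "\<And>y. y \<in> {0..T} \<Longrightarrow> dist y x < d \<Longrightarrow> dist (N y) (N x) < \<epsilon> / (2 * L)"
      using cN x unfolding continuous_on_iff by metis
    have "norm (G y - G x - 0) \<le> \<epsilon> * norm (y - x)" if y: "y \<in> {0..T}" "norm (y - x) < d" for y
    proof -
      have "\<bar>N y - N x\<bar> \<le> \<epsilon> / (2 * L)"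
        using d(2)[OF y(1)] y(2) by (simp add: dist_norm)
      then have *: "2 * L * \<bar>y - x\<bar> * \<bar>N y - N x\<bar> \<le> 2 * L * \<bar>y - x\<bar> * (\<epsilon> / (2 * L))"
        using L by (intro mult_left_mono) auto
      have "norm (G y - G x) \<le> 2 * L * \<bar>y - x\<bar> * \<bar>N y - N x\<bar>"
      proof (cases "x \<le> y")
        case True
        then have "norm (G y - G x) \<le> 2 * L * (y - x) * (N y - N x)"
          using G[of x y] x y by simp
        also have "\<dots> \<le> 2 * L * (y - x) * \<bar>N y - N x\<bar>"
          using L True by (intro mult_left_mono) auto
        finally show ?thesis using True by simp
      next
        case False
        then have "norm (G x - G y) \<le> 2 * L * (x - y) * (N x - N y)"
          using G[of y x] x y by simp
        also have "\<dots> \<le> 2 * L * (x - y) * \<bar>N x - N y\<bar>"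
          using L False by (intro mult_left_mono) auto
        finally show ?thesis using False by (simp add: norm_minus_commute abs_minus_commute)
      qed
      also have "\<dots> \<le> \<epsilon> * norm (y - x)"
        using * L by (simp add: mult_ac)
      finally show ?thesis by simp
    qed
    then show "\<exists>d>0. \<forall>y\<in>{0..T}. norm (y - x) < d \<longrightarrow> norm (G y - G x - 0) \<le> \<epsilon> * norm (y - x)"
      using d(1) by blast
  qed simp
  then obtain c where "\<And>x. x \<in> {0..T} \<Longrightarrow> G x = c"
    using has_derivative_zero_constant[of "{0..T}" G] by auto
  then have "G T = G 0"
    using T by simp
  moreover have "F 0 = 0"
    using F_eq[of 0] T by simp
  ultimately show ?thesis
    by (simp add: G_def algebra_simps)
qed

section \<open>Moments of the controlled states\<close>

text \<open>This is the solution \<open>m\<close> of the dual equation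
  \<open>\<i> m' + cnj \<nu> m = 0\<close> with final value \<open>y\<close> at time
  \<open>T\<close>. The conjugate is there because the kernel sits in the conjugate-linear slot of
  the inner product.\<close>

definition moment_kernel :: "real \<Rightarrow> complex \<Rightarrow> 'a::chilbert_space \<Rightarrow> real \<Rightarrow> 'a" where
  "moment_kernel T \<nu> y s = exp (- \<i> * cnj \<nu> * of_real (T - s)) *\<^sub>C y"

lemma cinner_moment_kernel:
  "cinner x (moment_kernel T \<nu> y s) = exp (\<i> * \<nu> * of_real (T - s)) * cinner x y"
  by (simp add: moment_kernel_def cinner_scaleC_right exp_cnj)

text \<open>Weight and kernel carry mutually inverse exponentials, which is why the recovered trace
  is the same at every time.\<close>

lemma exp_scaleC_moment_kernel:
  "exp (\<i> * cnj \<nu> * of_real (T - s)) *\<^sub>C a *\<^sub>C moment_kernel T \<nu> y s = a *\<^sub>C y"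
proof -
  have "exp (\<i> * cnj \<nu> * of_real (T - s)) * exp (- \<i> * cnj \<nu> * of_real (T - s)) = 1"
    unfolding exp_add[symmetric] by simp
  then have "exp (\<i> * cnj \<nu> * of_real (T - s)) * (a * exp (- \<i> * cnj \<nu> * of_real (T - s))) = a"
    by (metis mult.left_commute mult.right_neutral)
  then show ?thesis
    by (simp only: moment_kernel_def scaleC_scaleC)
qed

lemma continuous_on_moment_kernel: "continuous_on S (moment_kernel T \<nu> y)"
  unfolding moment_kernel_def
  by (intro bounded_bilinear.continuous_on[OF bounded_bilinear_scaleC] continuous_intros)

lemma L2_moment_kernel: "T > 0 \<Longrightarrow> moment_kernel T \<nu> y \<in> L2_space T"
  by (intro L2_continuous continuous_on_moment_kernel)

lemma has_vector_derivative_backward_exp: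
  "((\<lambda>s. exp (\<i> * \<nu> * of_real (T - s))) has_vector_derivative
     - \<i> * \<nu> * exp (\<i> * \<nu> * of_real (T - s))) (at s within S)"
proof -
  have "((\<lambda>z. exp (\<i> * \<nu> * (of_real T - z))) has_field_derivative
      - \<i> * \<nu> * exp (\<i> * \<nu> * (of_real T - of_real s))) (at (of_real s))"
    by (auto intro!: derivative_eq_intros simp: algebra_simps)
  from has_vector_derivative_real_field[OF this] show ?thesis
    by (simp add: has_vector_derivative_at_within)
qed

lemma integral_backward_exp_mult:
  fixes h F :: "real \<Rightarrow> complex"
  assumes T: "0 \<le> T" and h: "h absolutely_integrable_on {0..T}"
    and F: "\<And>t. t \<in> {0..T} \<Longrightarrow> (h has_integral F t) {0..t}"
  shows "integral {0..T} (\<lambda>s. exp (\<i> * \<nu> * of_real (T - s)) * h s)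
       = F T + \<i> * \<nu> * integral {0..T} (\<lambda>s. exp (\<i> * \<nu> * of_real (T - s)) * F s)"
proof -
  let ?e = "\<lambda>s. exp (\<i> * \<nu> * of_real (T - s))"
  have "integral {0..T} (\<lambda>s. ?e s * h s)
      = ?e T * F T - integral {0..T} (\<lambda>s. - \<i> * \<nu> * ?e s * F s)"
    by (rule integral_by_parts_absolutely_integrable[OF T h F has_vector_derivative_backward_exp])
       (auto intro!: continuous_intros)
  also have "integral {0..T} (\<lambda>s. - \<i> * \<nu> * ?e s * F s) = - \<i> * \<nu> * integral {0..T} (\<lambda>s. ?e s * F s)"
    by (simp add: mult.assoc flip: integral_mult_right)
  finally show ?thesis by simp
qed

text \<open>This is Duhamel's formula tested against \<open>\<eta>\<close>, on which
  \<open>L\<close> acts as the scalar \<open>\<nu>\<close>. The integrated equation says that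
  \<open>\<i> * c t + \<nu> * I t\<close> is a primitive of the scalar source, where
  \<open>I\<close> is a primitive of \<open>c\<close>.\<close>

lemma mild_solution_moment:
  assumes T: "0 \<le> T" and sol: "mild_solution D L T h u"
    and L: "\<And>x. x \<in> D \<Longrightarrow> cinner (L x) \<eta> = \<nu> * cinner x \<eta>"
    and h: "(\<lambda>t. cinner (h t) \<eta>) absolutely_integrable_on {0..T}"
  shows "cinner (u T) \<eta>
       = - \<i> * integral {0..T} (\<lambda>s. exp (\<i> * \<nu> * of_real (T - s)) * cinner (h s) \<eta>)"
proof -
  let ?e = "\<lambda>s. exp (\<i> * \<nu> * of_real (T - s))"
  define c where "c t = cinner (u t) \<eta>" for t
  define I where "I t = integral {0..t} c" for t
  have cu: "continuous_on {0..T} u"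
    using sol by (simp add: mild_solution_def)
  have cc: "continuous_on {0..T} c"
    unfolding c_def by (intro bounded_linear.continuous_on[OF bounded_linear_cinner_left] cu)
  have cI: "continuous_on {0..T} I"
    unfolding I_def by (intro indefinite_integral_continuous_1 integrable_continuous_real cc)
  have ui: "(u has_integral integral {0..t} u) {0..t}" if "t \<in> {0..T}" for t
    using that by (intro integrable_integral integrable_continuous_real continuous_on_subset[OF cu]) auto
  have cI_has: "(c has_integral I t) {0..t}" if "t \<in> {0..T}" for t
    unfolding I_def using that
    by (intro integrable_integral integrable_continuous_real continuous_on_subset[OF cc]) auto
  have I_eq: "cinner (integral {0..t} u) \<eta> = I t" if "t \<in> {0..T}" for t
    unfolding I_def c_def
    using has_integral_linear[OF ui[OF that] bounded_linear_cinner_left[of \<eta>]]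
    by (simp add: o_def integral_unique)
  have F: "((\<lambda>t. cinner (h t) \<eta>) has_integral (\<i> * c t + \<nu> * I t)) {0..t}" if t: "t \<in> {0..T}" for t
  proof -
    have *: "integral {0..t} u \<in> D" "(h has_integral (\<i> *\<^sub>C u t + L (integral {0..t} u))) {0..t}"
      using sol t by (auto simp: mild_solution_def)
    show ?thesis
      using has_integral_linear[OF *(2) bounded_linear_cinner_left[of \<eta>]]
      by (simp add: o_def cinner_add_left cinner_scaleC_left L[OF *(1)] I_eq[OF t] c_def)
  qed
  have int: "(\<lambda>s. ?e s * c s) integrable_on {0..T}" "(\<lambda>s. ?e s * I s) integrable_on {0..T}"
    using cc cI by (intro integrable_continuous_real continuous_intros; simp)+
  have "integral {0..T} (\<lambda>s. ?e s * cinner (h s) \<eta>)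
      = \<i> * c T + \<nu> * I T + \<i> * \<nu> * integral {0..T} (\<lambda>s. ?e s * (\<i> * c s + \<nu> * I s))"
    by (rule integral_backward_exp_mult[OF T h F])
  also have "integral {0..T} (\<lambda>s. ?e s * (\<i> * c s + \<nu> * I s))
      = integral {0..T} (\<lambda>s. \<i> * (?e s * c s) + \<nu> * (?e s * I s))"
    by (simp add: algebra_simps)
  also have "\<dots> = \<i> * integral {0..T} (\<lambda>s. ?e s * c s) + \<nu> * integral {0..T} (\<lambda>s. ?e s * I s)"
    using int by (subst integral_add) (simp_all add: integrable_on_mult_right)
  also have "integral {0..T} (\<lambda>s. ?e s * c s) = I T + \<i> * \<nu> * integral {0..T} (\<lambda>s. ?e s * I s)"
    \<comment> \<open>Integrating by parts once more, now for \<open>c\<close> with primitive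
      \<open>I\<close>, cancels all terms in \<open>I\<close> and leaves only
      \<open>\<i> * c T\<close>.\<close>
    by (rule integral_backward_exp_mult[OF T absolutely_integrable_continuous_real[OF cc] cI_has])
  finally have "integral {0..T} (\<lambda>s. ?e s * cinner (h s) \<eta>) = \<i> * c T"
    by (simp add: algebra_simps)
  then show ?thesis
    by (simp add: c_def)
qed

text \<open>In both uses \<open>y\<close> is the observation of \<open>\<eta>\<close>, and
  \<open>a\<close> is the sign of the source: 1 for \<open>B f\<close>, -1 for
  \<open>- B g\<close>.\<close>

lemma mild_solution_L2_moment:
  assumes T: "T > 0" and sol: "mild_solution D L T h u"
    and L: "\<And>x. x \<in> D \<Longrightarrow> cinner (L x) \<eta> = \<nu> * cinner x \<eta>"
    and f: "f \<in> L2_space T" and h: "\<And>t. cinner (h t) \<eta> = a * cinner (f t) y"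
  shows "cinner (u T) \<eta> = - \<i> * a * L2_inner T f (moment_kernel T \<nu> y)"
proof -
  have y: "(\<lambda>_. y) \<in> L2_space T"
    using T by (intro L2_continuous continuous_intros)
  have "(\<lambda>t. cinner (h t) \<eta>) absolutely_integrable_on {0..T}"
    using L2_cinner_absolutely_integrable[OF f y] unfolding h by (intro set_integrable_mult_right)
  then have "cinner (u T) \<eta>
      = - \<i> * integral {0..T} (\<lambda>s. exp (\<i> * \<nu> * of_real (T - s)) * cinner (h s) \<eta>)"
    using T by (intro mild_solution_moment[OF _ sol L]) auto
  also have "integral {0..T} (\<lambda>s. exp (\<i> * \<nu> * of_real (T - s)) * cinner (h s) \<eta>)
      = integral {0..T} (\<lambda>s. a * cinner (f s) (moment_kernel T \<nu> y s))"
    by (simp add: h cinner_moment_kernel algebra_simps)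
  also have "\<dots> = a * L2_inner T f (moment_kernel T \<nu> y)"
    by (simp add: L2_inner_eq_integral[OF f L2_moment_kernel[OF T]])
  finally show ?thesis by simp
qed

section \<open>Functions in H_0^1 and the moments of their derivatives\<close>

lemma H10_deriv_L2:
  assumes "T > 0" "has_H10_deriv T f f'"
  shows "f \<in> L2_space T" "f' \<in> L2_space T"
proof -
  have f': "f' \<in> L2_space T" "\<And>t. t \<in> {0..T} \<Longrightarrow> (f' has_integral f t) {0..t}"
    using assms(2) by (auto simp: has_H10_deriv_def)
  then have "f' integrable_on {0..T}"
    using assms(1) by (intro has_integral_integrable[of f' "f T"]) simp
  then have "continuous_on {0..T} (\<lambda>t. integral {0..t} f')"
    by (rule indefinite_integral_continuous_1)
  then have "continuous_on {0..T} f"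
    using integral_unique[OF f'(2)] by (rule continuous_on_eq)
  then show "f \<in> L2_space T" "f' \<in> L2_space T"
    using L2_continuous assms(1) f'(1) by auto
qed

lemma H10_scaleC:
  assumes T: "T > 0" and f: "f \<in> H10_space T"
  shows "(\<lambda>t. a *\<^sub>C f t) \<in> H10_space T"
proof -
  obtain f' where f': "has_H10_deriv T f f'"
    using f unfolding H10_space_def by blast
  have lin: "bounded_linear (\<lambda>x. a *\<^sub>C (x::'a))"
    by (rule bounded_bilinear.bounded_linear_right[OF bounded_bilinear_scaleC])
  have "has_H10_deriv T (\<lambda>t. a *\<^sub>C f t) (\<lambda>t. a *\<^sub>C f' t)"
    using f' L2_scaleC[OF T H10_deriv_L2(2)[OF T f']] has_integral_linear[OF _ lin, of f']
    by (auto simp: has_H10_deriv_def o_def)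
  then show ?thesis
    unfolding H10_space_def by blast
qed

text \<open>The end condition \<open>f T = 0\<close> removes the boundary term of the integration by
  parts; at time 0 the primitive vanishes by itself.\<close>

lemma H10_deriv_moment:
  assumes T: "T > 0" and f: "has_H10_deriv T f f'"
  shows "L2_inner T f' (moment_kernel T \<nu> y) = \<i> * \<nu> * L2_inner T f (moment_kernel T \<nu> y)"
proof -
  note L2 = H10_deriv_L2[OF T f]
  have y: "(\<lambda>_. y) \<in> L2_space T"
    using T by (intro L2_continuous continuous_intros)
  have "integral {0..T} (\<lambda>s. exp (\<i> * \<nu> * of_real (T - s)) * cinner (f' s) y)
      = cinner (f T) y + \<i> * \<nu> * integral {0..T} (\<lambda>s. exp (\<i> * \<nu> * of_real (T - s)) * cinner (f s) y)"
  proof (rule integral_backward_exp_mult)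
    show "((\<lambda>s. cinner (f' s) y) has_integral cinner (f t) y) {0..t}" if "t \<in> {0..T}" for t
      using f that has_integral_linear[OF _ bounded_linear_cinner_left[of y], of f' "f t" "{0..t}"]
      by (simp add: has_H10_deriv_def o_def)
  qed (use T L2_cinner_absolutely_integrable[OF L2(2) y] in auto)
  then show ?thesis
    using f L2 by (simp add: L2_inner_eq_integral L2_moment_kernel T cinner_moment_kernel has_H10_deriv_def)
qed

section \<open>The generalized spectral problem\<close>

text \<open>In the theorem the following lemmas are applied to \<open>C\<^sup>T\<close> with \<open>\<nu> k = - \<lambda>\<^sub>k\<close> and to its adjoint with
  \<open>\<nu> k = cnj \<lambda>\<^sub>k\<close>, the roles of the two control operators being interchanged.\<close>

lemma solves_gen_spectral_iff:
  fixes K :: "(real \<Rightarrow> 'y::chilbert_space) \<Rightarrow> real \<Rightarrow> 'y"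
    and W V :: "(real \<Rightarrow> 'y) \<Rightarrow> 'h::chilbert_space"
    and \<nu> :: "nat \<Rightarrow> complex"
  assumes T: "T > 0"
    and K: "\<And>f. f \<in> L2_space T \<Longrightarrow> K f \<in> L2_space T"
    and K_inner: "\<And>f g. f \<in> L2_space T \<Longrightarrow> g \<in> L2_space T \<Longrightarrow> L2_inner T (K f) g = cinner (W f) (V g)"
    and ctrl: "\<And>k. \<exists>g\<in>L2_space T. V g = \<eta> k"
    and total: "\<And>x. (\<And>k. cinner x (\<eta> k) = 0) \<Longrightarrow> x = 0"
    and biorth: "\<And>j k. cinner (\<theta> j) (\<eta> k) = (if j = k then 1 else 0)"
    and moment: "\<And>f k. f \<in> L2_space T \<Longrightarrow> cinner (W f) (\<eta> k) = a * L2_inner T f (moment_kernel T (\<nu> k) (p k))"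
    and inj: "inj \<nu>"
  shows "solves_gen_spectral T K (- \<i> * \<mu>) f \<longleftrightarrow>
    f \<in> H10_space T \<and> (\<exists>k c. \<mu> = \<nu> k \<and> c \<noteq> 0 \<and> W f = c *\<^sub>C \<theta> k)"
proof -
  let ?AE0 = "\<lambda>h. AE t in interval_measure T. h t = (0::'y)"
  have kernel: "?AE0 (K f) \<longleftrightarrow> W f = 0" if f: "f \<in> L2_space T" for f
  proof
    assume "?AE0 (K f)"
    then have "cinner (W f) (\<eta> k) = 0" for k
      using ctrl[of k] K_inner[OF f] L2_inner_AE_zero by metis
    then show "W f = 0" by (rule total)
  next
    assume "W f = 0"
    then show "?AE0 (K f)"
      using f by (intro L2_AE_zeroI) (simp_all add: K K_inner)
  qed
  have pencil: "?AE0 (\<lambda>t. K f' t + (- \<i> * \<mu>) *\<^sub>C K f t) \<longleftrightarrow>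
      (\<forall>k. \<mu> = \<nu> k \<or> cinner (W f) (\<eta> k) = 0)" if f': "has_H10_deriv T f f'" for f f'
  proof -
    note L2 = H10_deriv_L2[OF T f']
    define w where "w = W f' + (- \<i> * \<mu>) *\<^sub>C W f"
    have inner_w: "L2_inner T (\<lambda>t. K f' t + (- \<i> * \<mu>) *\<^sub>C K f t) g = cinner w (V g)"
      if "g \<in> L2_space T" for g
      using L2 that K by (simp only: L2_inner_add_scaleC_left K_inner w_def cinner_add_left cinner_scaleC_left)
    \<comment> \<open>On moments the time derivative is multiplication by
      \<open>\<i> * \<nu> k\<close>, so the pencil is diagonal in these coordinates.\<close>
    have w: "cinner w (\<eta> k) = \<i> * (\<nu> k - \<mu>) * cinner (W f) (\<eta> k)" for k
      using L2 by (simp add: w_def cinner_add_left cinner_scaleC_left moment H10_deriv_moment[OF T f']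
          algebra_simps)
    have "?AE0 (\<lambda>t. K f' t + (- \<i> * \<mu>) *\<^sub>C K f t) \<longleftrightarrow> w = 0"
    proof
      assume ae: "?AE0 (\<lambda>t. K f' t + (- \<i> * \<mu>) *\<^sub>C K f t)"
      have "cinner w (\<eta> k) = 0" for k
        using ctrl[of k] inner_w L2_inner_AE_zero[OF ae] by metis
      then show "w = 0" by (rule total)
    next
      assume "w = 0"
      then show "?AE0 (\<lambda>t. K f' t + (- \<i> * \<mu>) *\<^sub>C K f t)"
        using L2 K by (intro L2_AE_zeroI L2_add_scaleC) (simp_all add: inner_w[simplified])
    qed
    also have "\<dots> \<longleftrightarrow> (\<forall>k. cinner w (\<eta> k) = 0)"
      using total by auto
    finally show ?thesis
      by (auto simp: w)
  qed
  show ?thesis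
  proof
    assume "solves_gen_spectral T K (- \<i> * \<mu>) f"
    then obtain f' where nz: "\<not> ?AE0 (K f)" and f': "has_H10_deriv T f f'"
      and ae: "?AE0 (\<lambda>t. K f' t + (- \<i> * \<mu>) *\<^sub>C K f t)"
      unfolding solves_gen_spectral_def by blast
    have "W f \<noteq> 0"
      using nz kernel H10_deriv_L2[OF T f'] by blast
    then obtain k where k: "cinner (W f) (\<eta> k) \<noteq> 0"
      using total by blast
    have all: "\<mu> = \<nu> j \<or> cinner (W f) (\<eta> j) = 0" for j
      using pencil[OF f'] ae by blast
    then have \<mu>: "\<mu> = \<nu> k"
      using k by blast
    \<comment> \<open>Since \<nu> is injective, every coordinate other than the one at
      \<open>k\<close> must vanish, and totality identifies \<open>W f\<close> with its single
      component.\<close>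
    have "W f - cinner (W f) (\<eta> k) *\<^sub>C \<theta> k = 0"
    proof (rule total)
      fix j
      show "cinner (W f - cinner (W f) (\<eta> k) *\<^sub>C \<theta> k) (\<eta> j) = 0"
        using all[of j] \<mu> injD[OF inj, of k j]
        by (auto simp: cinner_diff_left cinner_scaleC_left biorth)
    qed
    then have "W f = cinner (W f) (\<eta> k) *\<^sub>C \<theta> k" by simp
    then show "f \<in> H10_space T \<and> (\<exists>k c. \<mu> = \<nu> k \<and> c \<noteq> 0 \<and> W f = c *\<^sub>C \<theta> k)"
      using f' \<mu> k unfolding H10_space_def by blast
  next
    assume "f \<in> H10_space T \<and> (\<exists>k c. \<mu> = \<nu> k \<and> c \<noteq> 0 \<and> W f = c *\<^sub>C \<theta> k)"
    then obtain f' k c where f': "has_H10_deriv T f f'" and \<mu>: "\<mu> = \<nu> k" and c: "c \<noteq> 0" "W f = c *\<^sub>C \<theta> k"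
      unfolding H10_space_def by blast
    have Wf: "cinner (W f) (\<eta> j) = (if k = j then c else 0)" for j
      by (simp add: c cinner_scaleC_left biorth)
    then have "W f \<noteq> 0"
      using c(1) by (metis cinner_zero_left)
    moreover have "\<forall>j. \<mu> = \<nu> j \<or> cinner (W f) (\<eta> j) = 0"
      by (simp add: Wf \<mu>)
    ultimately show "solves_gen_spectral T K (- \<i> * \<mu>) f"
      unfolding solves_gen_spectral_def using f' pencil[OF f'] kernel H10_deriv_L2[OF T f'] by blast
  qed
qed

text \<open>Both \<open>k\<close> and the scaled kernel represent the same functional of
  \<open>g\<close>. The moment formula has \<open>V g\<close> in the first slot while
  \<open>k_inner\<close> has it in the second; exchanging them conjugates \<open>a\<close>.\<close>

lemma continuous_rep_moment_kernel:
  assumes T: "T > 0" and k: "k \<in> L2_space T"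
    and k_inner: "\<And>g. g \<in> L2_space T \<Longrightarrow> L2_inner T k g = cinner x (V g)"
    and moment: "\<And>g. g \<in> L2_space T \<Longrightarrow> cinner (V g) x = a * L2_inner T g (moment_kernel T \<nu> y)"
  shows "\<exists>h. continuous_rep T k h"
    and "continuous_rep T k h \<Longrightarrow> t \<in> {0..T} \<Longrightarrow> h t = cnj a *\<^sub>C moment_kernel T \<nu> y t"
proof -
  let ?m = "\<lambda>t. cnj a *\<^sub>C moment_kernel T \<nu> y t"
  have cont: "continuous_on {0..T} ?m"
    by (intro bounded_bilinear.continuous_on[OF bounded_bilinear_scaleC] continuous_on_const
        continuous_on_moment_kernel)
  have ae: "AE t in interval_measure T. k t = ?m t"
  proof (rule L2_AE_eqI[OF k])
    show "L2_inner T k g = L2_inner T ?m g" if g: "g \<in> L2_space T" for g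
    proof -
      have "L2_inner T k g = cnj (a * L2_inner T g (moment_kernel T \<nu> y))"
        by (metis k_inner[OF g] moment[OF g] cinner_commute)
      also have "\<dots> = L2_inner T ?m g"
        by (simp add: L2_inner_scaleC_left) (metis L2_inner_commute)
      finally show ?thesis .
    qed
  qed (intro L2_continuous T cont)
  then have "continuous_rep T k ?m"
    unfolding continuous_rep_def using cont by (auto elim: eventually_mono)
  then show "\<exists>h. continuous_rep T k h" by blast
  assume h: "continuous_rep T k h" and t: "t \<in> {0..T}"
  have "AE t in interval_measure T. h t = ?m t"
    using h ae unfolding continuous_rep_def by (auto elim: eventually_elim2)
  then show "h t = ?m t"
    using continuous_AE_eq_on_interval[OF T _ cont _ t] h unfolding continuous_rep_def by blast
qed

section \<open>Moments of the two control operators, and multiples of eigenvectors\<close>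

lemma control_op_solution:
  assumes "well_posed T (control_solution D A B T)" "f \<in> L2_space T" "T > 0"
  obtains u where "control_solution D A B T f u" "control_op D A B T f = u T"
proof -
  obtain u where u: "control_solution D A B T f u"
    "\<And>u'. control_solution D A B T f u' \<Longrightarrow> \<forall>t\<in>{0..T}. u' t = u t"
    using assms unfolding well_posed_def by blast
  \<comment> \<open>Well-posedness gives all solutions the same state at time \<open>T\<close>, so
    the definite description denotes it.\<close>
  have "control_op D A B T f = u T"
    unfolding control_op_def
  proof (rule the_equality)
    show "\<exists>w. control_solution D A B T f w \<and> u T = w T"
      using u(1) by blast
    show "x = u T" if "\<exists>w. control_solution D A B T f w \<and> x = w T" for x
      using that u(2) \<open>T > 0\<close> by (metis atLeastAtMost_iff less_eq_real_def)
  qed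
  with u(1) show ?thesis by (rule that)
qed

lemma adj_control_op_solution:
  assumes "well_posed T (adj_control_solution D A B T)" "g \<in> L2_space T" "T > 0"
  obtains v where "adj_control_solution D A B T g v" "adj_control_op D A B T g = v T"
proof -
  obtain v where v: "adj_control_solution D A B T g v"
    "\<And>v'. adj_control_solution D A B T g v' \<Longrightarrow> \<forall>t\<in>{0..T}. v' t = v t"
    using assms unfolding well_posed_def by blast
  have "adj_control_op D A B T g = v T"
    unfolding adj_control_op_def
  proof (rule the_equality)
    show "\<exists>w. adj_control_solution D A B T g w \<and> v T = w T"
      using v(1) by blast
    show "x = v T" if "\<exists>w. adj_control_solution D A B T g w \<and> x = w T" for x
      using that v(2) \<open>T > 0\<close> by (metis atLeastAtMost_iff less_eq_real_def)
  qed
  with v(1) show ?thesis by (rule that)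
qed

text \<open>The generator here is \<open>- A\<close>, which acts on the functional given by \<psi>
  as \<open>- \<mu>\<close>; the source \<open>B f\<close> paired with \<psi> becomes
  \<open>f\<close> paired with \<open>Obs \<psi>\<close>.\<close>

lemma control_op_moment:
  assumes T: "T > 0" and A: "densely_defined_operator D A" and Obs: "is_adjoint B Obs"
    and wp: "well_posed T (control_solution D A B T)"
    and \<psi>: "eigenvector (adj_dom D A) (adj_op D A) (cnj \<mu>) \<psi>" and f: "f \<in> L2_space T"
  shows "cinner (control_op D A B T f) \<psi> = - \<i> * L2_inner T f (moment_kernel T (- \<mu>) (Obs \<psi>))"
proof -
  obtain u where u: "mild_solution D (\<lambda>x. - A x) T (\<lambda>t. B (f t)) u" "control_op D A B T f = u T"
    using control_op_solution[OF wp f T] unfolding control_solution_def by blast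
  have "cinner (- A x) \<psi> = - \<mu> * cinner x \<psi>" if "x \<in> D" for x
    using cinner_adj_op[OF A that] \<psi> by (simp add: eigenvector_def cinner_minus_left cinner_scaleC_right)
  then have "cinner (u T) \<psi> = - \<i> * 1 * L2_inner T f (moment_kernel T (- \<mu>) (Obs \<psi>))"
    using Obs by (intro mild_solution_L2_moment[OF T u(1) _ f]) (auto simp: is_adjoint_def)
  then show ?thesis by (simp add: u(2))
qed

text \<open>Here the generator is the adjoint of \<open>A\<close>, acting on the functional given by
  \<phi> as \<open>cnj \<mu>\<close>, and the negative source turns the factor \<open>- \<i>\<close>
  into \<open>\<i>\<close>.\<close>

lemma adj_control_op_moment:
  assumes T: "T > 0" and A: "densely_defined_operator D A" and Obs: "is_adjoint B Obs"
    and wp: "well_posed T (adj_control_solution D A B T)"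
    and \<phi>: "eigenvector D A \<mu> \<phi>" and g: "g \<in> L2_space T"
  shows "cinner (adj_control_op D A B T g) \<phi> = \<i> * L2_inner T g (moment_kernel T (cnj \<mu>) (Obs \<phi>))"
proof -
  obtain v where v: "mild_solution (adj_dom D A) (adj_op D A) T (\<lambda>t. - B (g t)) v"
      "adj_control_op D A B T g = v T"
    using adj_control_op_solution[OF wp g T] unfolding adj_control_solution_def by blast
  have "cinner (adj_op D A y) \<phi> = cnj \<mu> * cinner y \<phi>" if "y \<in> adj_dom D A" for y
    using cinner_adj_op[OF A _ that, of \<phi>] \<phi> unfolding eigenvector_def
    by (metis cinner_commute cinner_scaleC_left complex_cnj_mult)
  then have "cinner (v T) \<phi> = - \<i> * (- 1) * L2_inner T g (moment_kernel T (cnj \<mu>) (Obs \<phi>))"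
    using Obs by (intro mild_solution_L2_moment[OF T v(1) _ g]) (auto simp: is_adjoint_def cinner_minus_left)
  then show ?thesis by (simp add: v(2))
qed

lemma eigenvector_scaleC:
  assumes "densely_defined_operator D A" "eigenvector D A \<mu> x" "c \<noteq> 0"
  shows "eigenvector D A \<mu> (c *\<^sub>C x)"
proof -
  have "c *\<^sub>C x \<noteq> 0"
    using assms by (auto simp: eigenvector_def scaleC_eq_zero_iff)
  then show ?thesis
    using assms by (auto simp: eigenvector_def densely_defined_operator_def scaleC_scaleC mult.commute)
qed

text \<open>The adjoint is a definite description, so its value at a multiple of \<open>y\<close> is
  found by testing against the dense domain.\<close>

lemma adj_eigenvector_scaleC:
  assumes A: "densely_defined_operator D A" and y: "eigenvector (adj_dom D A) (adj_op D A) \<mu> y"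
    and c: "c \<noteq> 0"
  shows "eigenvector (adj_dom D A) (adj_op D A) \<mu> (c *\<^sub>C y)"
proof -
  have nz: "c *\<^sub>C y \<noteq> 0"
    using y c by (auto simp: eigenvector_def scaleC_eq_zero_iff)
  have y': "y \<in> adj_dom D A" "adj_op D A y = \<mu> *\<^sub>C y"
    using y by (auto simp: eigenvector_def)
  have *: "cinner (A x) (c *\<^sub>C y) = cinner x (\<mu> *\<^sub>C c *\<^sub>C y)" if "x \<in> D" for x
    using cinner_adj_op[OF A that y'(1)] by (simp add: y' cinner_scaleC_right)
  then have dom: "c *\<^sub>C y \<in> adj_dom D A"
    unfolding adj_dom_def by blast
  have "adj_op D A (c *\<^sub>C y) = \<mu> *\<^sub>C c *\<^sub>C y"
    using A * cinner_adj_op[OF A _ dom]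
    by (intro cinner_ext_dense[of D]) (auto simp: densely_defined_operator_def)
  with nz dom show ?thesis by (simp add: eigenvector_def)
qed

section \<open>Recovery of the spectral data\<close>

text \<open>The images \<open>C f\<close> and \<open>C' g\<close> are fixed only almost everywhere,
  so a value at \<open>T\<close> makes sense only for a continuous representative; its existence is
  part of the conclusion.\<close>

theorem mainTheorem2:
  fixes D :: "'h::chilbert_space set" and A :: "'h \<Rightarrow> 'h"
    and B :: "'y::chilbert_space \<Rightarrow> 'h" and Obs :: "'h \<Rightarrow> 'y" and T :: real
    and C C' :: "(real \<Rightarrow> 'y) \<Rightarrow> real \<Rightarrow> 'y"
    and W W' :: "(real \<Rightarrow> 'y) \<Rightarrow> 'h"
    and lam :: "nat \<Rightarrow> complex" and \<phi> \<psi> :: "nat \<Rightarrow> 'h"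
  assumes T: "T > 0"
    and A: "densely_defined_operator D A"
    and B: "bounded_clinear B"
    and Obs: "is_adjoint B Obs"
    and wp: "well_posed T (control_solution D A B T)"
    and wp': "well_posed T (adj_control_solution D A B T)"
    and W: "W = control_op D A B T" and W': "W' = adj_control_op D A B T"
    and C: "connecting_operator D A B T C"
    and C': "is_L2_adjoint T C C'"
    and spec: "op_spectrum D A = range lam" "inj lam" "\<And>k. alg_simple_eigenvalue D A (lam k)"
    and spec': "op_spectrum (adj_dom D A) (adj_op D A) = range (\<lambda>k. cnj (lam k))"
    and \<phi>: "\<And>k. eigenvector D A (lam k) (\<phi> k)" "riesz_basis \<phi>"
    and \<psi>: "\<And>k. eigenvector (adj_dom D A) (adj_op D A) (cnj (lam k)) (\<psi> k)" "riesz_basis \<psi>"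
    and biorth: "\<And>k l. cinner (\<phi> k) (\<psi> l) = (if k = l then 1 else 0)"
    and ctrl: "\<And>k. \<exists>f\<in>H10_space T. W f = \<phi> k"
    and ctrl': "\<And>k. \<exists>g\<in>H10_space T. W' g = \<psi> k"
  shows
    \<comment> \<open>the controls of the hypothesis solve the spectral problems and are normalized\<close>
    "(\<forall>k. \<forall>f\<in>H10_space T. \<forall>g\<in>H10_space T. W f = \<phi> k \<and> W' g = \<psi> k \<longrightarrow>
       solves_gen_spectral T C (\<i> * lam k) f \<and>
       solves_gen_spectral T C' (- \<i> * cnj (lam k)) g \<and>
       L2_inner T (C f) g = 1) \<and>
    \<comment> \<open>step 1: the spectral problems determine the spectrum and, up to scalars, the controls\<close>
    {\<mu>. \<exists>f. solves_gen_spectral T C (\<i> * \<mu>) f} = op_spectrum D A \<and>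
    {\<mu>. \<exists>g. solves_gen_spectral T C' (- \<i> * cnj \<mu>) g} = op_spectrum D A \<and>
    (\<forall>k f. solves_gen_spectral T C (\<i> * lam k) f \<longleftrightarrow>
           f \<in> H10_space T \<and> (\<exists>c. c \<noteq> 0 \<and> W f = c *\<^sub>C \<phi> k)) \<and>
    (\<forall>k g. solves_gen_spectral T C' (- \<i> * cnj (lam k)) g \<longleftrightarrow>
           g \<in> H10_space T \<and> (\<exists>c. c \<noteq> 0 \<and> W' g = c *\<^sub>C \<psi> k)) \<and>
    \<comment> \<open>step 2: solutions can be normalized\<close>
    (\<forall>k f g. solves_gen_spectral T C (\<i> * lam k) f \<and>
           solves_gen_spectral T C' (- \<i> * cnj (lam k)) g \<longrightarrow>
           (\<exists>a. a \<noteq> 0 \<and> solves_gen_spectral T C (\<i> * lam k) (\<lambda>t. a *\<^sub>C f t) \<and>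
                L2_inner T (C (\<lambda>t. a *\<^sub>C f t)) g = 1)) \<and>
    \<comment> \<open>step 3: normalized solutions yield biorthogonal eigenvectors and their traces\<close>
    (\<forall>f g.
           (\<forall>k. solves_gen_spectral T C (\<i> * lam k) (f k) \<and>
                solves_gen_spectral T C' (- \<i> * cnj (lam k)) (g k) \<and>
                L2_inner T (C (f k)) (g k) = 1) \<longrightarrow>
           (\<forall>k l. cinner (W (f k)) (W' (g l)) = (if k = l then 1 else 0)) \<and>
           (\<forall>k. eigenvector D A (lam k) (W (f k)) \<and>
                eigenvector (adj_dom D A) (adj_op D A) (cnj (lam k)) (W' (g k)) \<and>
                (\<exists>h. continuous_rep T (C (f k)) h) \<and>
                (\<forall>h. continuous_rep T (C (f k)) h \<longrightarrow>
                   (\<forall>t\<in>{0..T}.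
                      - \<i> *\<^sub>C Obs (W (f k)) = exp (- \<i> * lam k * of_real (t - T)) *\<^sub>C h t) \<and>
                   - \<i> *\<^sub>C Obs (W (f k)) = h T) \<and>
                (\<exists>h. continuous_rep T (C' (g k)) h) \<and>
                (\<forall>h. continuous_rep T (C' (g k)) h \<longrightarrow>
                   (\<forall>t\<in>{0..T}.
                      \<i> *\<^sub>C Obs (W' (g k)) = exp (\<i> * cnj (lam k) * of_real (t - T)) *\<^sub>C h t) \<and>
                   \<i> *\<^sub>C Obs (W' (g k)) = h T)))"
proof -
  have L2_ctrl: "\<exists>f\<in>L2_space T. Z f = y" if "\<exists>f\<in>H10_space T. Z f = y" for Z :: "(real \<Rightarrow> 'y) \<Rightarrow> 'h" and y
    using that H10_deriv_L2[OF T] unfolding H10_space_def by blast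
  have C_L2: "C f \<in> L2_space T" if "f \<in> L2_space T" for f
    using C that by (simp add: connecting_operator_def)
  have C_inner: "L2_inner T (C f) g = cinner (W f) (W' g)" if "f \<in> L2_space T" "g \<in> L2_space T" for f g
    using C that by (simp add: connecting_operator_def W W')
  have C'_L2: "C' g \<in> L2_space T" if "g \<in> L2_space T" for g
    using C' that by (simp add: is_L2_adjoint_def)
  have C'_inner: "L2_inner T (C' g) f = cinner (W' g) (W f)" if "g \<in> L2_space T" "f \<in> L2_space T" for f g
  proof -
    have "L2_inner T (C' g) f = cnj (L2_inner T (C f) g)"
      using C' that L2_inner_commute[of T "C' g" f] by (simp add: is_L2_adjoint_def)
    then show ?thesis
      by (simp add: C_inner that flip: cinner_commute)
  qed
  have W_moment: "cinner (W f) x = - \<i> * L2_inner T f (moment_kernel T (- \<mu>) (Obs x))"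
    if "eigenvector (adj_dom D A) (adj_op D A) (cnj \<mu>) x" "f \<in> L2_space T" for f x \<mu>
    unfolding W by (rule control_op_moment[OF T A Obs wp that])
  have W'_moment: "cinner (W' g) x = \<i> * L2_inner T g (moment_kernel T (cnj \<mu>) (Obs x))"
    if "eigenvector D A \<mu> x" "g \<in> L2_space T" for g x \<mu>
    unfolding W' by (rule adj_control_op_moment[OF T A Obs wp' that])
  have biorth': "cinner (\<psi> j) (\<phi> k) = (if j = k then 1 else 0)" for j k
    using biorth[of k j] cinner_commute[of "\<psi> j" "\<phi> k"] by auto
  \<comment> \<open>The general lemma uses the parameter \<open>- \<i> * \<mu>\<close>. The
    generator \<open>- A\<close> has the numbers \<open>- lam k\<close>, and replacing
    \<open>\<mu>\<close> by \<open>- \<mu>\<close> restores the sign of the pencil.\<close>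
  have "solves_gen_spectral T C (- \<i> * (- \<mu>)) f \<longleftrightarrow>
      f \<in> H10_space T \<and> (\<exists>k c. - \<mu> = - lam k \<and> c \<noteq> 0 \<and> W f = c *\<^sub>C \<phi> k)" for \<mu> f
    using spec(2)
    by (intro solves_gen_spectral_iff[where \<nu>="\<lambda>k. - lam k", OF T C_L2 C_inner L2_ctrl[OF ctrl']
          riesz_basis_total[OF \<psi>(2)] biorth W_moment[OF \<psi>(1)]]) (auto simp: inj_def)
  then have iff: "solves_gen_spectral T C (\<i> * \<mu>) f \<longleftrightarrow>
      f \<in> H10_space T \<and> (\<exists>k c. \<mu> = lam k \<and> c \<noteq> 0 \<and> W f = c *\<^sub>C \<phi> k)" for \<mu> f
    by simp
  have "solves_gen_spectral T C' (- \<i> * cnj \<mu>) g \<longleftrightarrow>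
      g \<in> H10_space T \<and> (\<exists>k c. cnj \<mu> = cnj (lam k) \<and> c \<noteq> 0 \<and> W' g = c *\<^sub>C \<psi> k)" for \<mu> g
    using spec(2)
    by (intro solves_gen_spectral_iff[where \<nu>="\<lambda>k. cnj (lam k)", OF T C'_L2 C'_inner L2_ctrl[OF ctrl]
          riesz_basis_total[OF \<phi>(2)] biorth' W'_moment[OF \<phi>(1)]]) (auto simp: inj_def)
  then have iff': "solves_gen_spectral T C' (- \<i> * cnj \<mu>) g \<longleftrightarrow>
      g \<in> H10_space T \<and> (\<exists>k c. \<mu> = lam k \<and> c \<noteq> 0 \<and> W' g = c *\<^sub>C \<psi> k)" for \<mu> g
    by simp
  have solves: "solves_gen_spectral T C (\<i> * lam k) f \<longleftrightarrow>
      f \<in> H10_space T \<and> (\<exists>c. c \<noteq> 0 \<and> W f = c *\<^sub>C \<phi> k)" for k f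
    unfolding iff using injD[OF spec(2)] by blast
  have solves': "solves_gen_spectral T C' (- \<i> * cnj (lam k)) g \<longleftrightarrow>
      g \<in> H10_space T \<and> (\<exists>c. c \<noteq> 0 \<and> W' g = c *\<^sub>C \<psi> k)" for k g
    unfolding iff' using injD[OF spec(2)] by blast
  have H10_L2: "f \<in> L2_space T" if "f \<in> H10_space T" for f :: "real \<Rightarrow> 'y"
    using that H10_deriv_L2[OF T] unfolding H10_space_def by blast
  have ex: "\<exists>f. solves_gen_spectral T C (\<i> * lam k) f" for k
    unfolding solves using ctrl[of k] by (metis scaleC_one zero_neq_one)
  have ex': "\<exists>g. solves_gen_spectral T C' (- \<i> * cnj (lam k)) g" for k
    unfolding solves' using ctrl'[of k] by (metis scaleC_one zero_neq_one)
  have controls: "solves_gen_spectral T C (\<i> * lam k) f \<and>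
      solves_gen_spectral T C' (- \<i> * cnj (lam k)) g \<and> L2_inner T (C f) g = 1"
    if "f \<in> H10_space T" "g \<in> H10_space T" "W f = \<phi> k" "W' g = \<psi> k" for k f g
  proof (intro conjI)
    show "solves_gen_spectral T C (\<i> * lam k) f" "solves_gen_spectral T C' (- \<i> * cnj (lam k)) g"
      unfolding solves solves' using that by (metis scaleC_one zero_neq_one)+
    show "L2_inner T (C f) g = 1"
      using that by (simp add: C_inner H10_L2 biorth)
  qed
  have spectrum: "{\<mu>. \<exists>f. solves_gen_spectral T C (\<i> * \<mu>) f} = op_spectrum D A"
    unfolding spec(1)
  proof (intro equalityI subsetI)
    show "\<mu> \<in> range lam" if "\<mu> \<in> {\<mu>. \<exists>f. solves_gen_spectral T C (\<i> * \<mu>) f}" for \<mu>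
      using that unfolding iff by blast
  qed (use ex in blast)
  have spectrum': "{\<mu>. \<exists>g. solves_gen_spectral T C' (- \<i> * cnj \<mu>) g} = op_spectrum D A"
    unfolding spec(1)
  proof (intro equalityI subsetI)
    show "\<mu> \<in> range lam" if "\<mu> \<in> {\<mu>. \<exists>g. solves_gen_spectral T C' (- \<i> * cnj \<mu>) g}" for \<mu>
      using that unfolding iff' by blast
  qed (use ex' in blast)
  have normalize: "\<exists>a. a \<noteq> 0 \<and> solves_gen_spectral T C (\<i> * lam k) (\<lambda>t. a *\<^sub>C f t) \<and>
      L2_inner T (C (\<lambda>t. a *\<^sub>C f t)) g = 1"
    if fg: "solves_gen_spectral T C (\<i> * lam k) f" "solves_gen_spectral T C' (- \<i> * cnj (lam k)) g" for k f g
  proof -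
    obtain c where c: "c \<noteq> 0" "W f = c *\<^sub>C \<phi> k" and f: "f \<in> H10_space T"
      using fg(1) unfolding solves by blast
    obtain d where d: "d \<noteq> 0" "W' g = d *\<^sub>C \<psi> k" and g: "g \<in> H10_space T"
      using fg(2) unfolding solves' by blast
    \<comment> \<open>The unnormalized pairing of \<open>C f\<close> with \<open>g\<close> is
      \<open>c * cnj d\<close>.\<close>
    define a where "a = 1 / (c * cnj d)"
    have a: "a \<noteq> 0" using c d by (simp add: a_def)
    have af: "(\<lambda>t. a *\<^sub>C f t) \<in> H10_space T"
      using f H10_scaleC[OF T] by blast
    \<comment> \<open>Homogeneity of \<open>W\<close> is recovered from its moments, which are
      linear in the control, and totality of \<psi>.\<close>
    have "W (\<lambda>t. a *\<^sub>C f t) - a *\<^sub>C W f = 0"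
    proof (rule riesz_basis_total[OF \<psi>(2)])
      show "cinner (W (\<lambda>t. a *\<^sub>C f t) - a *\<^sub>C W f) (\<psi> j) = 0" for j
        by (simp add: cinner_diff_left cinner_scaleC_left W_moment[OF \<psi>(1)] H10_L2 f af L2_inner_scaleC_left)
    qed
    then have Waf: "W (\<lambda>t. a *\<^sub>C f t) = (a * c) *\<^sub>C \<phi> k"
      by (simp add: c scaleC_scaleC)
    have "a * c \<noteq> 0" using a c by simp
    then have "solves_gen_spectral T C (\<i> * lam k) (\<lambda>t. a *\<^sub>C f t)"
      unfolding solves using af Waf by blast
    moreover have "L2_inner T (C (\<lambda>t. a *\<^sub>C f t)) g = 1"
    proof -
      have "L2_inner T (C (\<lambda>t. a *\<^sub>C f t)) g = a * c * cnj d"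
        by (simp add: C_inner H10_L2 af g Waf d(2) cinner_scaleC_left cinner_scaleC_right biorth)
      then show ?thesis
        using c(1) d(1) by (simp add: a_def)
    qed
    ultimately show ?thesis
      using a by blast
  qed
  have biorthogonal: "cinner (W (f k)) (W' (g l)) = (if k = l then 1 else 0)"
    if fg: "\<And>k. solves_gen_spectral T C (\<i> * lam k) (f k) \<and>
      solves_gen_spectral T C' (- \<i> * cnj (lam k)) (g k) \<and> L2_inner T (C (f k)) (g k) = 1" for f g k l
  \<comment> \<open>Normalization settles the diagonal; off the diagonal, biorthogonality of \<phi>
    and \<psi> makes every choice of scalars work.\<close>
  proof (cases "k = l")
    case True
    have "f k \<in> H10_space T" "g k \<in> H10_space T"
      using fg[of k] unfolding solves solves' by blast+
    then show ?thesis
      using True fg[of k] C_inner[of "f k" "g k"] H10_L2 by simp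
  next
    case False
    obtain c d where "W (f k) = c *\<^sub>C \<phi> k" "W' (g l) = d *\<^sub>C \<psi> l"
      using fg[of k] fg[of l] unfolding solves solves' by blast
    then show ?thesis
      using False by (simp add: cinner_scaleC_left cinner_scaleC_right biorth)
  qed
  have eig: "eigenvector D A (lam k) (W f)" if "solves_gen_spectral T C (\<i> * lam k) f" for k f
    using that eigenvector_scaleC[OF A \<phi>(1)] unfolding solves by metis
  have eig': "eigenvector (adj_dom D A) (adj_op D A) (cnj (lam k)) (W' g)"
    if "solves_gen_spectral T C' (- \<i> * cnj (lam k)) g" for k g
    using that adj_eigenvector_scaleC[OF A \<psi>(1)] unfolding solves' by metis
  have trace: "(\<exists>h. continuous_rep T (C f) h) \<and> (\<forall>h. continuous_rep T (C f) h \<longrightarrow>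
      (\<forall>t\<in>{0..T}. - \<i> *\<^sub>C Obs (W f) = exp (- \<i> * lam k * of_real (t - T)) *\<^sub>C h t) \<and>
      - \<i> *\<^sub>C Obs (W f) = h T)"
    if f: "solves_gen_spectral T C (\<i> * lam k) f" for k f
  proof -
    have fL2: "f \<in> L2_space T" using f H10_L2 unfolding solves by blast
    have rep: "\<exists>h. continuous_rep T (C f) h"
      "\<And>h t. continuous_rep T (C f) h \<Longrightarrow> t \<in> {0..T} \<Longrightarrow>
        h t = cnj \<i> *\<^sub>C moment_kernel T (cnj (lam k)) (Obs (W f)) t"
      \<comment> \<open>The moment formula is applied to the eigenvector \<open>W f\<close> itself,
        not to \<open>\<phi> k\<close>, so the unknown scalar between them never enters.\<close>
      by (rule continuous_rep_moment_kernel[where V=W', OF T C_L2[OF fL2] C_inner[OF fL2]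
            W'_moment[OF eig[OF f]]]; assumption)+
    have h: "- \<i> *\<^sub>C Obs (W f) = exp (- \<i> * lam k * of_real (t - T)) *\<^sub>C h t"
      if "continuous_rep T (C f) h" "t \<in> {0..T}" for h t
    proof -
      \<comment> \<open>This rewrites the exponent so that the weight becomes the exact inverse of
        the kernel for \<open>\<nu> = cnj (lam k)\<close>.\<close>
      have "- \<i> * lam k * of_real (t - T) = \<i> * cnj (cnj (lam k)) * of_real (T - t)"
        by (simp add: algebra_simps)
      then show ?thesis
        unfolding rep(2)[OF that] by (simp only: exp_scaleC_moment_kernel) simp
    qed
    have "- \<i> *\<^sub>C Obs (W f) = h T" if "continuous_rep T (C f) h" for h
      using h[OF that, of T] T by simp
    with h rep(1) show ?thesis by blast
  qed
  have trace': "(\<exists>h. continuous_rep T (C' g) h) \<and> (\<forall>h. continuous_rep T (C' g) h \<longrightarrow>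
      (\<forall>t\<in>{0..T}. \<i> *\<^sub>C Obs (W' g) = exp (\<i> * cnj (lam k) * of_real (t - T)) *\<^sub>C h t) \<and>
      \<i> *\<^sub>C Obs (W' g) = h T)"
    if g: "solves_gen_spectral T C' (- \<i> * cnj (lam k)) g" for k g
  proof -
    have gL2: "g \<in> L2_space T" using g H10_L2 unfolding solves' by blast
    have rep: "\<exists>h. continuous_rep T (C' g) h"
      "\<And>h t. continuous_rep T (C' g) h \<Longrightarrow> t \<in> {0..T} \<Longrightarrow>
        h t = cnj (- \<i>) *\<^sub>C moment_kernel T (- lam k) (Obs (W' g)) t"
      by (rule continuous_rep_moment_kernel[where V=W, OF T C'_L2[OF gL2] C'_inner[OF gL2]
            W_moment[OF eig'[OF g]]]; assumption)+
    have h: "\<i> *\<^sub>C Obs (W' g) = exp (\<i> * cnj (lam k) * of_real (t - T)) *\<^sub>C h t"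
      if "continuous_rep T (C' g) h" "t \<in> {0..T}" for h t
    proof -
      have "\<i> * cnj (lam k) * of_real (t - T) = \<i> * cnj (- lam k) * of_real (T - t)"
        by (simp add: algebra_simps)
      then show ?thesis
        unfolding rep(2)[OF that] by (simp only: exp_scaleC_moment_kernel) simp
    qed
    have "\<i> *\<^sub>C Obs (W' g) = h T" if "continuous_rep T (C' g) h" for h
      using h[OF that, of T] T by simp
    with h rep(1) show ?thesis by blast
  qed
  have recover: "(\<forall>k l. cinner (W (f k)) (W' (g l)) = (if k = l then 1 else 0)) \<and>
      (\<forall>k. eigenvector D A (lam k) (W (f k)) \<and>
        eigenvector (adj_dom D A) (adj_op D A) (cnj (lam k)) (W' (g k)) \<and>
        (\<exists>h. continuous_rep T (C (f k)) h) \<and>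
        (\<forall>h. continuous_rep T (C (f k)) h \<longrightarrow>
          (\<forall>t\<in>{0..T}. - \<i> *\<^sub>C Obs (W (f k)) = exp (- \<i> * lam k * of_real (t - T)) *\<^sub>C h t) \<and>
          - \<i> *\<^sub>C Obs (W (f k)) = h T) \<and>
        (\<exists>h. continuous_rep T (C' (g k)) h) \<and>
        (\<forall>h. continuous_rep T (C' (g k)) h \<longrightarrow>
          (\<forall>t\<in>{0..T}. \<i> *\<^sub>C Obs (W' (g k)) = exp (\<i> * cnj (lam k) * of_real (t - T)) *\<^sub>C h t) \<and>
          \<i> *\<^sub>C Obs (W' (g k)) = h T))"
    (is "_ \<and> (\<forall>k. ?R k)")
    if fg: "\<forall>k. solves_gen_spectral T C (\<i> * lam k) (f k) \<and>
      solves_gen_spectral T C' (- \<i> * cnj (lam k)) (g k) \<and> L2_inner T (C (f k)) (g k) = 1" for f g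
  proof (rule conjI[OF _ allI])
    show "\<forall>k l. cinner (W (f k)) (W' (g l)) = (if k = l then 1 else 0)"
      using biorthogonal[of f g] fg by blast
    fix k
    have f: "solves_gen_spectral T C (\<i> * lam k) (f k)"
      and g: "solves_gen_spectral T C' (- \<i> * cnj (lam k)) (g k)"
      using fg by blast+
    note * = eig[OF f] eig'[OF g] trace[OF f, THEN conjunct1] trace[OF f, THEN conjunct2]
      trace'[OF g, THEN conjunct1] trace'[OF g, THEN conjunct2]
    show "?R k" by (intro conjI *)
  qed
  show ?thesis
    apply (intro conjI spectrum spectrum')
    subgoal using controls by blast
    subgoal using solves by blast
    subgoal using solves' by blast
    subgoal using normalize by blast
    subgoal using recover by (intro allI impI)
    done
qed

end
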